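(* Consider the Gaussian family on $\mathbb{R}^d$, with $c_l=x$, $c_u=\mathrm{vecs}(xx^\top)=w_2$ (i.e. $r=1$) and natural parameters $\theta_l=\Sigma^{-1}\mu$, $\theta_u=-\tfrac12K\,\mathrm{vecs}(\Sigma^{-1})$. Let $\theta_k$ be the natural parameters at time $k\Delta t$, for some $k\in\mathbb{N}$, where $\Delta t>0$ is the measurement sampling time. Then the sum-of-squares relaxation (defined in the context) of the natural parameters $\theta_t$ between two consecutive measurement sampling times, $t\in(k\Delta t,(k+1)\Delta t)$, can be written compactly as $$\frac{d}{dt}\begin{bmatrix}\theta_{l,t}\\ \nu_t\end{bmatrix}=\begin{bmatrix}\Sigma^{-1}\frac{d\eta_l}{dt}+E_\mu(g_{uu}^{(0)})^{-1}\left(E_\mu^\top\frac{d\eta_l}{dt}-\frac{d\eta_u}{dt}\right)\\[4pt] -\Delta(L_t)\,\tilde K\,C(L_t)\,K^{-1}(g_{uu}^{(0)})^{-1}\left(\frac{d\eta_u}{dt}-E_\mu^\top\frac{d\eta_l}{dt}\right)\end{bmatrix},$$ where $\eta_l=\mathbb{E}_\theta[c_l]$ and $\eta_u=\mathbb{E}_\theta[c_u]$.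
   Context: **Filtering setting.** The state satisfies the SDE $dx_t=f(x_t)\,dt+\varrho(x_t)\,dW_t$ on $\mathbb{R}^d$, with $W_t$ a Wiener process in $\mathbb{R}^{d_w}$ and $f,\varrho$ satisfying standard conditions for existence and uniqueness of solutions. Its backward Kolmogorov operator is $\mathcal{L}(\varphi)=\sum_{i=1}^d f_i\frac{\partial\varphi}{\partial x_i}+\frac12\sum_{i,j=1}^d(\varrho\varrho^\top)_{ij}\frac{\partial^2\varphi}{\partial x_i\partial x_j}$ (componentwise on vector functions). With $c=[c_l^\top,c_u^\top]^\top$, $p_\theta(x)=\exp(c(x)^\top\theta-\psi(\theta))$ is the Gaussian density with mean $\mu$ and covariance $\Sigma\succ0$; $\mathbb{E}_\theta$ is expectation under $p_\theta$; $g(\theta)$ is the Fisher information matrix (covariance of $c$ under $p_\theta$). The derivatives $\frac{d\eta_l}{dt}:=\mathbb{E}_{\theta_t}[\mathcal{L}(c_l)]$, $\frac{d\eta_u}{dt}:=\mathbb{E}_{\theta_t}[\mathcal{L}(c_u)]$, and $\frac{d\eta_t}{dt}=[\frac{d\eta_l}{dt}^\top,\frac{d\eta_u}{dt}^\top]^\top$. The (unrelaxed) prediction equation is $\frac{d\theta_t}{dt}=g(\theta_t)^{-1}\frac{d\eta_t}{dt}$. **Matrix notation.** $\mathrm{lt}(n)=\frac12n(n+1)$. $\mathcal{S}_n$, $\mathcal{S}_n^+$, $\mathcal{L}_n$, $\mathcal{L}_n^+$ are respectively the symmetric, symmetric positive definite, lower triangular, and lower triangular with positive diagonal, real $n\times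 n$ matrices. $\mathrm{vec}$ is column stacking. $\mathrm{vecs}(A)=[d_{A,0}^\top,d_{A,1}^\top,\dots,d_{A,n-1}]^\top\in\mathbb{R}^{\mathrm{lt}(n)}$ stacks the main diagonal $d_{A,0}$ and the sub-diagonals $d_{A,i}$ of $A$; $\mathrm{vecs}^{-1}$ denotes the inverse of its restriction to $\mathcal{S}_n$. $\mathrm{vecl}:\mathcal{L}_n^+\to\mathbb{R}^{\mathrm{lt}(n)}$ is $\mathrm{vecl}(L)=[\log(d_{L,0})^\top,d_{L,1}^\top,\dots,d_{L,n-1}^\top]^\top$ (log entrywise); its Jacobian in $\mathrm{vecs}$ coordinates is $\mathrm{vecl}_{\ast,L}=\mathrm{diag}(1/d_{L,0},\,1_{\mathrm{lt}(n)-n})$. $\mathscr{L}:\mathcal{S}_n^+\to\mathcal{L}_n^+$ maps $P$ to its Cholesky factor $L$, $P=LL^\top$; $\mathscr{L}_{\ast,P}$ is its differential. $A^+$ is the Moore–Penrose pseudo-inverse. $D_n\in\mathbb{R}^{n^2\times\mathrm{lt}(n)}$ satisfies $D_n\mathrm{vecs}(A)=\mathrm{vec}(A)$ for $A\in\mathcal{S}_n$; $E_n\in\mathbb{R}^{n^2\times\mathrm{lt}(n)}$ satisfies $E_n\mathrm{vecs}(X)=\mathrm{vec}(X)$ for $X\in\mathcal{L}_n$; $M_n\in\mathbb{R}^{n^2\times n^2}$ satisfies $M_n\mathrm{vec}(A)=\mathrm{vec}(A^\top)$. With $n=d$: $C(L)=D_d^+(L^{-1}\otimes L^{-1})D_d$;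 $\Delta(L)=\mathrm{vecl}_{\ast,L}E_d^+(I_d\otimes L)E_d$; $\tilde K$ is the $\mathrm{lt}(d)\times\mathrm{lt}(d)$ diagonal matrix with $\tilde K_{k,k}=\frac12$ for $k\le d$, $1$ for $k>d$; $K$ is the $\mathrm{lt}(d)\times\mathrm{lt}(d)$ diagonal matrix with $K_{k,k}=1$ for $k\le d$, $2$ for $k>d$. Also $$E_\mu=(I_d\otimes\mu^\top+\mu^\top\otimes I_d)(D_d^+)^\top,\qquad g_{uu}^{(0)}=D_d^+(\Sigma\otimes\Sigma)(I+M_d)(D_d^+)^\top,$$ where $\mu,\Sigma$ are the mean and covariance corresponding to $\theta_t$. **Sum-of-squares relaxation.** Here $m_l=d$, $m_u=\mathrm{lt}(d)$. The SOS matrix is $P_t=\frac12\Sigma^{-1}\in\mathcal{S}_d^+$, with $\theta_{u,t}=-K\,\mathrm{vecs}(P_t)$ (so that $c_u^\top\theta_{u,t}=-x^\top P_tx$), $L_t=\mathscr{L}(P_t)$ and log-Cholesky coordinate $\nu_t=\mathrm{vecl}(L_t)$. The sum-of-squares relaxation on $(k\Delta t,(k+1)\Delta t)$ is the system, started from the values corresponding to $\theta_k$, $$\frac{d\theta_{l,t}}{dt}=[\,I_{m_l}\ \ 0_{m_l\times m_u}]\,g(\theta_t)^{-1}\frac{d\eta_t}{dt},\qquad \frac{d\nu_t}{dt}=\mathrm{vecl}_{\ast,L_t}\circ\mathscr{L}_{\ast,P_t}\left(\frac{dP_t}{dt}\right),$$ $$\frac{dP_t}{dt}=-\mathrm{vecs}^{-1}\left(K^{-1}[\,0_{m_u\times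 m_l}\ \ I_{m_u}]\,g(\theta_t)^{-1}\frac{d\eta_t}{dt}\right),$$ where $\theta_t=[\theta_{l,t}^\top,\theta_{u,t}^\top]^\top$ and $\theta_{u,t}=-K\,\mathrm{vecs}(L_tL_t^\top)$, $L_t=\mathrm{vecl}^{-1}(\nu_t)$. *)

theory Defs
  imports "HOL-Analysis.Analysis"
begin

subsection \<open>Half-vectorisation and associated matrices\<close>

text \<open>
  The dimension \<open>d\<close> is \<open>CARD('n)\<close> for a finite linearly ordered index type. Coordinates of
  \<open>\<real>\<^bsup>lt(d)\<^esup>\<close> are labelled by the positions \<open>(i, j)\<close>, \<open>j \<le> i\<close>, of the lower triangle instead of
  by numbers \<open>1, \<dots>, lt(d)\<close>; the coordinates stacked first (\<open>k \<le> d\<close>) are those with \<open>i = j\<close>.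
\<close>

typedef (overloaded) ('n::linorder) tri = "{(i::'n, j::'n). j \<le> i}"
  by auto

instance tri :: ("{finite, linorder}") finite
proof
  have "inj (Rep_tri :: 'a tri \<Rightarrow> 'a \<times> 'a)"
    by (simp add: inj_on_def Rep_tri_inject)
  then show "finite (UNIV :: 'a tri set)"
    using finite_imageD[of Rep_tri "UNIV :: 'a tri set"] by (metis finite)
qed

lemma card_tri: "CARD('n::{finite,linorder} tri) = CARD('n) * (CARD('n) + 1) div 2"
proof -
  define A where "A = {(i::'n, j::'n). j \<le> i}"
  define B where "B = {(i::'n, j::'n). i \<le> j}"
  have "CARD('n tri) = card A"
    unfolding A_def using type_definition.card[OF type_definition_tri] by blast
  moreover have "card A = card B"
    by (rule bij_betw_same_card[of prod.swap])
       (auto simp: A_def B_def bij_betw_def inj_on_def image_iff)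
  moreover have "card (A \<union> B) = CARD('n) * CARD('n)"
  proof -
    have "A \<union> B = UNIV" by (auto simp: A_def B_def)
    then show ?thesis by (metis card_cartesian_product UNIV_Times_UNIV)
  qed
  moreover have "card (A \<inter> B) = CARD('n)"
  proof -
    have "A \<inter> B = (\<lambda>i. (i, i)) ` UNIV" by (auto simp: A_def B_def)
    then show ?thesis by (simp add: card_image inj_on_def)
  qed
  moreover have "card A + card B = card (A \<union> B) + card (A \<inter> B)"
    by (rule card_Un_Int) auto
  ultimately show ?thesis by simp
qed

definition tri_row :: "'n::linorder tri \<Rightarrow> 'n" where
  "tri_row k = fst (Rep_tri k)"

definition tri_col :: "'n::linorder tri \<Rightarrow> 'n" where
  "tri_col k = snd (Rep_tri k)"

definition sym_mats :: "(real^'n^'n) set" where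
  "sym_mats = {A. transpose A = A}"

definition spd_mats :: "(real^'n^'n) set" where
  "spd_mats = {A. transpose A = A \<and> (\<forall>x. x \<noteq> 0 \<longrightarrow> 0 < x \<bullet> (A *v x))}"

definition lower_mats :: "(real^'n::{finite,wellorder}^'n::_) set" where
  "lower_mats = {A. \<forall>i j. i < j \<longrightarrow> A $ i $ j = 0}"

definition lower_pos_mats :: "(real^'n::{finite,wellorder}^'n::_) set" where
  "lower_pos_mats = {A \<in> lower_mats. \<forall>i. 0 < A $ i $ i}"

text \<open>Column stacking: an index of \<open>\<real>\<^bsup>n\<^sup>2\<^esup>\<close> is a pair (column, row).\<close>

definition mvec :: "real^'n^'n \<Rightarrow> real^('n \<times> 'n)" where
  "mvec A = (\<chi> p. A $ snd p $ fst p)"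

definition vecs :: "real^'n::{finite,wellorder}^'n::_ \<Rightarrow> real^('n tri)" where
  "vecs A = (\<chi> k. A $ tri_row k $ tri_col k)"

definition vecs_inv :: "real^('n tri) \<Rightarrow> real^'n::{finite,wellorder}^'n::_" where
  "vecs_inv = the_inv_into sym_mats vecs"

definition vecl :: "real^'n::{finite,wellorder}^'n::_ \<Rightarrow> real^('n tri)" where
  "vecl L = (\<chi> k. if tri_row k = tri_col k then ln (L $ tri_row k $ tri_col k)
                  else L $ tri_row k $ tri_col k)"

definition vecl_inv :: "real^('n tri) \<Rightarrow> real^'n::{finite,wellorder}^'n::_" where
  "vecl_inv = the_inv_into lower_pos_mats vecl"

definition vecl_jac :: "real^'n::{finite,wellorder}^'n::_ \<Rightarrow> real^('n tri)^('n tri)" where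
  "vecl_jac L = (\<chi> k l. if k = l then (if tri_row k = tri_col k
                                       then 1 / L $ tri_row k $ tri_col k else 1) else 0)"

definition chol :: "real^'n::{finite,wellorder}^'n::_ \<Rightarrow> real^'n::_^'n::_" where
  "chol P = (THE L. L \<in> lower_pos_mats \<and> P = L ** transpose L)"

text \<open>
  Differential at \<open>x\<close> of a map defined on a relatively open subset \<open>S\<close> of a linear subspace.
  The Frechet derivative within \<open>S\<close> is unique only on that subspace, so this is only
  meaningful when applied to vectors of the subspace.
\<close>

definition differential ::
  "'a::real_normed_vector set \<Rightarrow> ('a \<Rightarrow> 'b::real_normed_vector) \<Rightarrow> 'a \<Rightarrow> 'a \<Rightarrow> 'b" where
  "differential S F x = frechet_derivative F (at x within S)"

definition pinv :: "real^'m^'k \<Rightarrow> real^'k^'m" where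
  "pinv A = (THE X. A ** X ** A = A \<and> X ** A ** X = X \<and>
                    transpose (A ** X) = A ** X \<and> transpose (X ** A) = X ** A)"

definition kron :: "real^'k^'m \<Rightarrow> real^'q^'p \<Rightarrow> real^('k \<times> 'q)^('m \<times> 'p)" where
  "kron A B = (\<chi> r c. A $ fst r $ fst c * B $ snd r $ snd c)"

definition D_mat :: "real^('n::{finite,wellorder} tri)^('n \<times> 'n)" where
  "D_mat = (THE D. \<forall>A \<in> sym_mats. D *v vecs A = mvec A)"

definition E_mat :: "real^('n::{finite,wellorder} tri)^('n \<times> 'n)" where
  "E_mat = (THE E. \<forall>X \<in> lower_mats. E *v vecs X = mvec X)"

definition M_mat :: "real^('n::finite \<times> 'n)^('n \<times> 'n)" where
  "M_mat = (THE M. \<forall>A. M *v mvec A = mvec (transpose A))"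

definition K_mat :: "real^('n::{finite,wellorder} tri)^('n tri)" where
  "K_mat = (\<chi> k l. if k = l then (if tri_row k = tri_col k then 1 else 2) else 0)"

definition Kt_mat :: "real^('n::{finite,wellorder} tri)^('n tri)" where
  "Kt_mat = (\<chi> k l. if k = l then (if tri_row k = tri_col k then 1 / 2 else 1) else 0)"

definition C_mat :: "real^'n::{finite,wellorder}^'n::_ \<Rightarrow> real^('n tri)^('n tri)" where
  "C_mat L = pinv D_mat ** kron (matrix_inv L) (matrix_inv L) ** D_mat"

definition Delta_mat :: "real^'n::{finite,wellorder}^'n::_ \<Rightarrow> real^('n tri)^('n tri)" where
  "Delta_mat L = vecl_jac L ** pinv E_mat ** kron (mat 1) L ** E_mat"

text \<open>
  The products of \<open>I\<^sub>d\<close> with the row vector \<open>\<mu>\<^sup>T\<close> have rows indexed by \<open>'n \<times> 1\<close> and \<open>1 \<times> 'n\<close>,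
  which are both identified with \<open>'n\<close>.
\<close>

definition E_mu :: "real^'n::{finite,wellorder} \<Rightarrow> real^('n tri)^'n::_" where
  "E_mu \<mu> = ((\<chi> i. kron (mat 1 :: real^'n::_^'n::_) (rowvector \<mu> :: real^'n::_^1) $ (i, 1)) +
             (\<chi> i. kron (rowvector \<mu> :: real^'n::_^1) (mat 1 :: real^'n::_^'n::_) $ (1, i)))
            ** transpose (pinv D_mat)"

definition guu0 :: "real^'n::{finite,wellorder}^'n::_ \<Rightarrow> real^('n tri)^('n tri)" where
  "guu0 \<Sigma> = pinv D_mat ** kron \<Sigma> \<Sigma> ** (mat 1 + M_mat) ** transpose (pinv D_mat)"

subsection \<open>The Gaussian exponential family\<close>

definition stack :: "'a^'m \<Rightarrow> 'a^'k \<Rightarrow> 'a^('m + 'k)" where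
  "stack u v = (\<chi> s. case s of Inl i \<Rightarrow> u $ i | Inr j \<Rightarrow> v $ j)"

definition upper_block :: "'a^('m::finite + 'k::finite) \<Rightarrow> 'a^'m" where
  "upper_block w = (\<chi> i. w $ Inl i)"

definition lower_block :: "'a^('m::finite + 'k::finite) \<Rightarrow> 'a^'k" where
  "lower_block w = (\<chi> j. w $ Inr j)"

definition c_l :: "real^'n \<Rightarrow> real^'n" where
  "c_l x = x"

definition c_u :: "real^'n::{finite,wellorder} \<Rightarrow> real^('n tri)" where
  "c_u x = vecs (\<chi> i j. x $ i * x $ j)"

definition c_stat :: "real^'n::{finite,wellorder} \<Rightarrow> real^('n + 'n tri)" where
  "c_stat x = stack (c_l x) (c_u x)"

definition psi :: "real^('n::{finite,wellorder} + 'n tri) \<Rightarrow> real" where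
  "psi \<theta> = ln (LINT x|lborel. exp (c_stat x \<bullet> \<theta>))"

definition p_dens :: "real^('n::{finite,wellorder} + 'n tri) \<Rightarrow> real^'n::_ \<Rightarrow> real" where
  "p_dens \<theta> x = exp (c_stat x \<bullet> \<theta> - psi \<theta>)"

definition expect :: "real^('n::{finite,wellorder} + 'n tri) \<Rightarrow>
    (real^'n::_ \<Rightarrow> 'b::{banach,second_countable_topology}) \<Rightarrow> 'b" where
  "expect \<theta> \<phi> = (LINT x|lborel. p_dens \<theta> x *\<^sub>R \<phi> x)"

definition covar :: "real^('n::{finite,wellorder} + 'n tri) \<Rightarrow>
    (real^'n::_ \<Rightarrow> real^'m) \<Rightarrow> real^'m^'m" where
  "covar \<theta> \<phi> = (\<chi> i j. expect \<theta> (\<lambda>x. (\<phi> x $ i - expect \<theta> \<phi> $ i) * (\<phi> x $ j - expect \<theta> \<phi> $ j)))"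

definition mean_of :: "real^('n::{finite,wellorder} + 'n tri) \<Rightarrow> real^'n::_" where
  "mean_of \<theta> = expect \<theta> (\<lambda>x. x)"

definition cov_of :: "real^('n::{finite,wellorder} + 'n tri) \<Rightarrow> real^'n::_^'n::_" where
  "cov_of \<theta> = covar \<theta> (\<lambda>x. x)"

definition fisher :: "real^('n::{finite,wellorder} + 'n tri) \<Rightarrow> real^('n + 'n tri)^('n + 'n tri)" where
  "fisher \<theta> = covar \<theta> c_stat"

definition natural_param ::
  "real^'n::{finite,wellorder} \<Rightarrow> real^'n::_^'n::_ \<Rightarrow> real^('n + 'n tri)" where
  "natural_param \<mu> \<Sigma> = stack (matrix_inv \<Sigma> *v \<mu>) (- (1/2) *\<^sub>R (K_mat *v vecs (matrix_inv \<Sigma>)))"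

subsection \<open>State equation and its backward Kolmogorov operator\<close>

text \<open>
  Conditions for existence and uniqueness of solutions: local Lipschitz continuity and the
  monotone growth condition. Globally Lipschitz coefficients satisfy both.
\<close>

definition sde_coeffs :: "(real^'n \<Rightarrow> real^'n) \<Rightarrow> (real^'n \<Rightarrow> real^'w^'n) \<Rightarrow> bool" where
  "sde_coeffs f \<rho> \<longleftrightarrow>
     local_lipschitz (UNIV :: real set) UNIV (\<lambda>_. f) \<and>
     local_lipschitz (UNIV :: real set) UNIV (\<lambda>_. \<rho>) \<and>
     (\<exists>B. \<forall>x. x \<bullet> f x + (norm (\<rho> x))\<^sup>2 / 2 \<le> B * (1 + (norm x)\<^sup>2))"

definition pderiv_at :: "'n \<Rightarrow> (real^'n \<Rightarrow> real) \<Rightarrow> real^'n \<Rightarrow> real" where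
  "pderiv_at i \<phi> x = deriv (\<lambda>h. \<phi> (x + h *\<^sub>R axis i 1)) 0"

definition backward_op :: "(real^'n \<Rightarrow> real^'n) \<Rightarrow> (real^'n \<Rightarrow> real^'w^'n) \<Rightarrow>
    (real^'n \<Rightarrow> real^'m) \<Rightarrow> real^'n \<Rightarrow> real^'m" where
  "backward_op f \<rho> \<phi> x = (\<chi> k.
     (\<Sum>i\<in>UNIV. f x $ i * pderiv_at i (\<lambda>y. \<phi> y $ k) x) +
     1/2 * (\<Sum>i\<in>UNIV. \<Sum>j\<in>UNIV. (\<rho> x ** transpose (\<rho> x)) $ i $ j *
                                 pderiv_at i (pderiv_at j (\<lambda>y. \<phi> y $ k)) x))"

definition deta_l :: "(real^'n::{finite,wellorder} \<Rightarrow> real^'n::_) \<Rightarrow> (real^'n::_ \<Rightarrow> real^'w^'n::_) \<Rightarrow>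
    real^('n + 'n tri) \<Rightarrow> real^'n::_" where
  "deta_l f \<rho> \<theta> = expect \<theta> (backward_op f \<rho> c_l)"

definition deta_u :: "(real^'n::{finite,wellorder} \<Rightarrow> real^'n::_) \<Rightarrow> (real^'n::_ \<Rightarrow> real^'w^'n::_) \<Rightarrow>
    real^('n + 'n tri) \<Rightarrow> real^('n tri)" where
  "deta_u f \<rho> \<theta> = expect \<theta> (backward_op f \<rho> c_u)"

definition deta :: "(real^'n::{finite,wellorder} \<Rightarrow> real^'n::_) \<Rightarrow> (real^'n::_ \<Rightarrow> real^'w^'n::_) \<Rightarrow>
    real^('n + 'n tri) \<Rightarrow> real^('n + 'n tri)" where
  "deta f \<rho> \<theta> = stack (deta_l f \<rho> \<theta>) (deta_u f \<rho> \<theta>)"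

subsection \<open>Sum-of-squares relaxation\<close>

definition sos_P :: "real^('n::{finite,wellorder} tri) \<Rightarrow> real^'n::_^'n::_" where
  "sos_P \<nu> = vecl_inv \<nu> ** transpose (vecl_inv \<nu>)"

definition sos_theta ::
  "real^'n::{finite,wellorder} \<Rightarrow> real^('n tri) \<Rightarrow> real^('n + 'n tri)" where
  "sos_theta \<theta>l \<nu> = stack \<theta>l (- (K_mat *v vecs (sos_P \<nu>)))"

definition sos_dP :: "(real^'n::{finite,wellorder} \<Rightarrow> real^'n::_) \<Rightarrow> (real^'n::_ \<Rightarrow> real^'w^'n::_) \<Rightarrow>
    real^('n + 'n tri) \<Rightarrow> real^'n::_^'n::_" where
  "sos_dP f \<rho> \<theta> =
     - vecs_inv (matrix_inv K_mat *v lower_block (matrix_inv (fisher \<theta>) *v deta f \<rho> \<theta>))"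

definition sos_relaxation_at :: "(real^'n::{finite,wellorder} \<Rightarrow> real^'n::_) \<Rightarrow>
    (real^'n::_ \<Rightarrow> real^'w^'n::_) \<Rightarrow> (real \<Rightarrow> real^'n::_) \<Rightarrow> (real \<Rightarrow> real^('n tri)) \<Rightarrow> real \<Rightarrow> bool" where
  "sos_relaxation_at f \<rho> \<theta>l \<nu> t \<longleftrightarrow>
     (let \<theta> = sos_theta (\<theta>l t) (\<nu> t); P = sos_P (\<nu> t); L = chol P in
       (\<theta>l has_vector_derivative upper_block (matrix_inv (fisher \<theta>) *v deta f \<rho> \<theta>)) (at t) \<and>
       (\<nu> has_vector_derivative
          (differential lower_pos_mats vecl L \<circ> differential spd_mats chol P) (sos_dP f \<rho> \<theta>)) (at t))"

end

theory Submission
  imports Defs "HOL-Probability.Distributions"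
begin

text \<open>
  Both sides of the equivalence are derivative statements at one time, and a vector curve is
  differentiable exactly when its two blocks are (\<open>has_vector_derivative_stack_iff\<close>). So it is enough
  to show, for every \<open>\<theta>\<^sub>l\<close> and \<open>\<nu>\<close>, that the two prescribed velocities coincide. With
  \<open>P = L L\<^sup>T\<close> the matrix that \<open>\<nu>\<close> encodes, the density is proportional to
  \<open>exp (\<theta>\<^sub>l \<bullet> x - x \<bullet> P x)\<close>; hence its covariance is \<open>\<Sigma> = (2 P)\<^sup>-\<^sup>1\<close>, and the Cholesky factor of
  \<open>\<Sigma>\<^sup>-\<^sup>1 / 2\<close> is \<open>L\<close> again. Two independent computations remain.

  The inverse Fisher matrix. Put \<open>y = x - \<mu>\<close> and \<open>E = E\<^sub>\<mu>\<close>. The centred statistic \<open>c\<^sub>u\<close> is the linear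
  term \<open>E\<^sup>T y\<close> plus the purely quadratic term \<open>vecs (y y\<^sup>T - \<Sigma>)\<close>. Odd moments of \<open>y\<close> vanish, so the
  quadratic term is uncorrelated with everything linear, and its own covariance is
  \<open>g\<^sub>u\<^sub>u\<^sup>(\<^sup>0\<^sup>)\<close> by the formula of Isserlis for fourth moments. The Fisher matrix therefore
  has the blocks \<open>\<Sigma>\<close>, \<open>\<Sigma> E\<close>, \<open>E\<^sup>T \<Sigma>\<close> and \<open>g\<^sub>u\<^sub>u\<^sup>(\<^sup>0\<^sup>) + E\<^sup>T \<Sigma> E\<close>, and \<open>g\<^sub>u\<^sub>u\<^sup>(\<^sup>0\<^sup>)\<close> is the
  Schur complement of \<open>\<Sigma>\<close>. Block elimination gives the natural gradient
  (\<open>block_matrix_inv\<close>, \<open>matrix_inv_fisher_mult\<close>). The moments come from the moment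
  generating function of the linear functionals of \<open>y\<close>, which is a matter of completing a square and
  translating Lebesgue measure: comparison of power series gives the moments of one functional
  (\<open>moments_of_gaussian_mgf\<close>), polarisation the mixed moments of up to four (\<open>isserlis\<close>).

  The log-Cholesky velocity. If \<open>P = L L\<^sup>T\<close> moves in the symmetric direction \<open>H\<close> and \<open>L\<close> in the lower
  triangular direction \<open>X\<close>, then \<open>X L\<^sup>T + L X\<^sup>T = H\<close>. So \<open>L\<^sup>-\<^sup>1 X\<close> is a lower triangular matrix
  whose sum with its own transpose is \<open>L\<^sup>-\<^sup>1 H L\<^sup>-\<^sup>T\<close>: it must be the lower triangle of that matrix with
  the diagonal halved. In coordinates this is the factor \<open>K' C(L)\<close>, where \<open>K'\<close> is the
  halving matrix, and multiplication by \<open>L\<close> followed by the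
  derivative of \<open>vecl\<close> is \<open>\<Delta>(L)\<close> (\<open>log_cholesky_differential\<close>). That the Cholesky map is
  differentiable at all follows from the inverse function theorem for \<open>L \<mapsto> L L\<^sup>T\<close> in \<open>vecs\<close>
  coordinates.
\<close>

section \<open>Half-vectorisation and its matrices\<close>

lemma tri_le: "tri_col k \<le> tri_row (k::'n::linorder tri)"
  using Rep_tri[of k] by (auto simp: tri_row_def tri_col_def)

text \<open>
  The position of the unordered pair \<open>{i, j}\<close>; being symmetric in its arguments it lets one
  formula unfold a coordinate vector into a symmetric matrix.
\<close>

definition tri_of :: "'n::linorder \<Rightarrow> 'n \<Rightarrow> 'n tri" where
  "tri_of i j = Abs_tri (max i j, min i j)"

lemma tri_row_of [simp]: "tri_row (tri_of i j) = max i j"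
  and tri_col_of [simp]: "tri_col (tri_of i j) = min i j"
  by (simp_all add: tri_row_def tri_col_def tri_of_def Abs_tri_inverse min_def max_def)

lemma tri_eqI: "tri_row k = tri_row l \<Longrightarrow> tri_col k = tri_col l \<Longrightarrow> k = l"
  by (metis Rep_tri_inject prod.collapse tri_col_def tri_row_def)

lemma tri_of_row_col [simp]: "tri_of (tri_row k) (tri_col k) = k"
  by (rule tri_eqI) (use tri_le[of k] in \<open>auto simp: max_def min_def\<close>)

lemma tri_of_commute: "tri_of i j = tri_of j i"
  by (simp add: tri_of_def max.commute min.commute)

lemma tri_of_col_row [simp]: "tri_of (tri_col k) (tri_row k) = k"
  by (simp add: tri_of_commute[of "tri_col k"])

lemma tri_of_diag: "tri_row k = tri_col k \<Longrightarrow> tri_of (tri_col k) (tri_col k) = k"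
  by (metis tri_of_row_col)

lemma tri_eq_iff:
  "k = tri_of a b \<longleftrightarrow> tri_row k = a \<and> tri_col k = b \<or> tri_row k = b \<and> tri_col k = a"
  using tri_of_row_col[of k] tri_of_col_row[of k] by (auto simp: max_def min_def)

text \<open>
  Inverses of \<^const>\<open>vecs\<close> on the symmetric and on the lower triangular matrices. The matrices
  \<^const>\<open>D_mat\<close> and \<^const>\<open>E_mat\<close> are \<^const>\<open>mvec\<close> composed with these two maps, so that every matrix
  product below turns into a computation with square matrices.
\<close>

definition symm_of :: "real^('n tri) \<Rightarrow> real^'n::{finite,wellorder}^'n::_" where
  "symm_of v = (\<chi> i j. v $ tri_of i j)"

definition lower_of :: "real^('n tri) \<Rightarrow> real^'n::{finite,wellorder}^'n::_" where
  "lower_of v = (\<chi> i j. if j \<le> i then v $ tri_of i j else 0)"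

definition unmvec :: "real^('n \<times> 'n) \<Rightarrow> real^'n^'n" where
  "unmvec w = (\<chi> i j. w $ (j, i))"

lemma mvec_unmvec [simp]: "mvec (unmvec w) = w"
  by (simp add: mvec_def unmvec_def vec_eq_iff)
lemma unmvec_mvec [simp]: "unmvec (mvec w) = w"
  by (simp add: mvec_def unmvec_def vec_eq_iff)

lemma symm_of_in: "symm_of v \<in> sym_mats"
  by (simp add: symm_of_def sym_mats_def transpose_def vec_eq_iff tri_of_commute)

lemma lower_of_in: "lower_of v \<in> lower_mats"
  by (auto simp: lower_of_def lower_mats_def)

lemma vecs_symm_of [simp]: "vecs (symm_of v) = v"
  by (simp add: vecs_def symm_of_def vec_eq_iff)

lemma vecs_lower_of [simp]: "vecs (lower_of v) = v"
  by (simp add: vecs_def lower_of_def vec_eq_iff tri_le)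

lemma symm_of_vecs: "A \<in> sym_mats \<Longrightarrow> symm_of (vecs A) = A"
  by (auto simp: vecs_def symm_of_def sym_mats_def transpose_def vec_eq_iff max_def min_def)

lemma lower_of_vecs: "A \<in> lower_mats \<Longrightarrow> lower_of (vecs A) = A"
  by (auto simp: vecs_def lower_of_def lower_mats_def vec_eq_iff max_def min_def)

lemma linear_mvec: "linear mvec" and linear_unmvec: "linear unmvec"
  and linear_vecs: "linear vecs" and linear_symm_of: "linear symm_of"
  and linear_lower_of: "linear lower_of"
  by (auto intro!: linearI simp: mvec_def unmvec_def vecs_def symm_of_def lower_of_def vec_eq_iff)

lemma vecs_inv_eq: "vecs_inv v = symm_of v"
  unfolding vecs_inv_def
  by (rule the_inv_into_f_eq) (auto simp: symm_of_in intro: inj_on_inverseI symm_of_vecs)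

lemma linear_matrix_works:
  fixes f :: "real^'n \<Rightarrow> real^'m"
  assumes "linear f"
  shows "matrix f *v x = f x"
  using assms by (simp add: matrix_works linear_matrix_vector_mul_eq)

lemma D_mat_mult:
  fixes v :: "real^('n::{finite,wellorder} tri)"
  shows "D_mat *v v = mvec (symm_of v)"
proof -
  define D where "D = matrix (mvec \<circ> symm_of :: real^('n::{finite,wellorder} tri) \<Rightarrow> real^('n \<times> 'n))"
  have D: "D *v w = mvec (symm_of w)" for w
    unfolding D_def using linear_matrix_works[OF linear_compose[OF linear_symm_of linear_mvec]] by (simp add: o_def)
  have "D_mat = D"
    unfolding D_mat_def
  proof (rule the_equality)
    show "\<forall>A\<in>sym_mats. D *v vecs A = mvec A" by (simp add: D symm_of_vecs)
    show "D' = D" if "\<forall>A\<in>sym_mats. D' *v vecs A = mvec A" for D'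
      using that by (metis D matrix_eq symm_of_in vecs_symm_of)
  qed
  then show ?thesis using D by simp
qed

lemma E_mat_mult:
  fixes v :: "real^('n::{finite,wellorder} tri)"
  shows "E_mat *v v = mvec (lower_of v)"
proof -
  define D where "D = matrix (mvec \<circ> lower_of :: real^('n tri) \<Rightarrow> real^('n \<times> 'n))"
  have D: "D *v w = mvec (lower_of w)" for w
    unfolding D_def using linear_matrix_works[OF linear_compose[OF linear_lower_of linear_mvec]] by (simp add: o_def)
  have "E_mat = D"
    unfolding E_mat_def
  proof (rule the_equality)
    show "\<forall>A\<in>lower_mats. D *v vecs A = mvec A" by (simp add: D lower_of_vecs)
    show "D' = D" if "\<forall>A\<in>lower_mats. D' *v vecs A = mvec A" for D'
      using that by (metis D matrix_eq lower_of_in vecs_lower_of)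
  qed
  then show ?thesis using D by simp
qed

lemma M_mat_mult:
  fixes A :: "real^'n^'n"
  shows "M_mat *v mvec A = mvec (transpose A)"
proof -
  define D where "D = matrix (\<lambda>w. mvec (transpose (unmvec w)) :: real^('n \<times> 'n))"
  have "linear (\<lambda>w. mvec (transpose (unmvec w)) :: real^('n \<times> 'n))"
    by (auto intro!: linearI simp: mvec_def unmvec_def transpose_def vec_eq_iff)
  then have D: "D *v mvec w = mvec (transpose w)" for w
    unfolding D_def by (simp add: linear_matrix_works)
  have "M_mat = D"
    unfolding M_mat_def
  proof (rule the_equality)
    show "\<forall>A. D *v mvec A = mvec (transpose A)" by (simp add: D)
    show "D' = D" if "\<forall>A. D' *v mvec A = mvec (transpose A)" for D'
      using that by (metis D matrix_eq mvec_unmvec)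
  qed
  then show ?thesis using D by simp
qed

text \<open>
  A left inverse \<open>X\<close> with \<open>A X\<close> symmetric satisfies all four Penrose equations. Uniqueness uses that
  \<open>A X\<close> and \<open>A Y\<close> are orthogonal projections onto the same space, the column space of \<open>A\<close>.
\<close>

lemma pinv_eqI:
  fixes A :: "real^'m^'k"
  assumes left: "X ** A = mat 1" and sym: "transpose (A ** X) = A ** X"
  shows "pinv A = X"
  unfolding pinv_def
proof (rule the_equality)
  show "A ** X ** A = A \<and> X ** A ** X = X \<and> transpose (A ** X) = A ** X \<and> transpose (X ** A) = X ** A"
    using left sym by (metis matrix_mul_assoc matrix_mul_lid matrix_mul_rid transpose_mat)
  fix Y
  assume Y: "A ** Y ** A = A \<and> Y ** A ** Y = Y \<and> transpose (A ** Y) = A ** Y \<and> transpose (Y ** A) = Y ** A"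
  have YA: "Y ** A = mat 1"
    using Y left by (metis matrix_mul_assoc matrix_mul_lid)
  \<comment> \<open>Both products are symmetric and each absorbs the other, so they agree.\<close>
  have "A ** Y = (A ** X) ** (A ** Y)"
    using left by (metis matrix_mul_assoc matrix_mul_lid)
  also have "\<dots> = transpose ((A ** Y) ** (A ** X))"
    using Y sym by (simp add: matrix_transpose_mul)
  also have "\<dots> = A ** X"
    using YA sym by (metis matrix_mul_assoc matrix_mul_lid)
  finally have "A ** Y = A ** X" .
  then show "Y = X"
    using YA left by (metis matrix_mul_assoc matrix_mul_lid)
qed

text \<open>
  \<^const>\<open>D_mat\<close> has the symmetric matrices as its range, and the orthogonal projection onto these is
  \<open>A \<mapsto> (A + A\<^sup>T) / 2\<close>; so its pseudo-inverse averages the two mirror entries.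
\<close>

lemma pinv_D_mat_mult:
  fixes w :: "real^('n::{finite,wellorder} \<times> 'n)"
  shows "(pinv D_mat *v w) $ k = (w $ (tri_col k, tri_row k) + w $ (tri_row k, tri_col k)) / 2"
proof -
  define h :: "real^('n \<times> 'n) \<Rightarrow> real^('n tri)" where
    "h w = (\<chi> k. (w $ (tri_col k, tri_row k) + w $ (tri_row k, tri_col k)) / 2)" for w
  define X where "X = matrix h"
  have "linear h"
    by (auto intro!: linearI simp: h_def vec_eq_iff algebra_simps add_divide_distrib)
  then have X: "X *v w = h w" for w
    unfolding X_def by (simp add: linear_matrix_works)
  have DX: "((D_mat ** X) *v w) $ (a, b) = (w $ (a, b) + w $ (b, a)) / 2" for w a b
    by (auto simp: matrix_vector_mul_assoc[symmetric] X D_mat_mult h_def mvec_def symm_of_def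
        max_def min_def algebra_simps)
  have "pinv D_mat = X"
  proof (rule pinv_eqI)
    show "X ** D_mat = mat 1"
      unfolding matrix_eq
      by (simp add: matrix_vector_mul_assoc[symmetric] X D_mat_mult h_def mvec_def symm_of_def vec_eq_iff)
    show "transpose (D_mat ** X) = D_mat ** X"
    proof -
      have H: "(D_mat ** X) $ (a, b) $ p = (axis p 1 $ (a, b) + axis p 1 $ (b, a)) / 2" for a b p
        using DX[of "axis p 1" a b] by (simp only: matrix_vector_mult_basis column_def vec_lambda_beta)
      have "(D_mat ** X) $ (a, b) $ (c, d) = (D_mat ** X) $ (c, d) $ (a, b)" for a b c d
        unfolding H axis_def by (cases "a = c"; cases "b = d"; cases "a = d"; cases "b = c"; simp)
      then show ?thesis by (simp add: transpose_def vec_eq_iff)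
    qed
  qed
  then show ?thesis by (simp add: X h_def)
qed

text \<open>
  Here the orthogonal projection onto the range discards the entries above the diagonal, and the
  pseudo-inverse just reads off the lower triangle of an arbitrary matrix.
\<close>

lemma pinv_E_mat_mult:
  fixes A :: "real^'n::{finite,wellorder}^'n::_"
  shows "pinv E_mat *v mvec A = vecs A"
proof -
  define h :: "real^('n \<times> 'n) \<Rightarrow> real^('n tri)" where "h w = vecs (unmvec w)" for w
  define X where "X = matrix h"
  have "linear h"
    unfolding h_def by (rule linear_compose[OF linear_unmvec linear_vecs, unfolded o_def])
  then have X: "X *v w = h w" for w
    unfolding X_def by (simp add: linear_matrix_works)
  have EX: "((E_mat ** X) *v w) $ (a, b) = (if a \<le> b then w $ (a, b) else 0)" for w a b
    by (auto simp: matrix_vector_mul_assoc[symmetric] X E_mat_mult h_def mvec_def lower_of_def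
        vecs_def unmvec_def max_def min_def)
  have "pinv E_mat = X"
  proof (rule pinv_eqI)
    show "X ** E_mat = mat 1"
      unfolding matrix_eq
      by (simp add: matrix_vector_mul_assoc[symmetric] X E_mat_mult h_def)
    show "transpose (E_mat ** X) = E_mat ** X"
    proof -
      have H: "(E_mat ** X) $ (a, b) $ p = (if a \<le> b then axis p 1 $ (a, b) else 0)" for a b p
        using EX[of "axis p 1" a b] by (simp only: matrix_vector_mult_basis column_def vec_lambda_beta)
      have "(E_mat ** X) $ (a, b) $ (c, d) = (E_mat ** X) $ (c, d) $ (a, b)" for a b c d
        unfolding H axis_def by (cases "a = c"; cases "b = d"; cases "a = d"; cases "b = c"; simp)
      then show ?thesis by (simp add: transpose_def vec_eq_iff)
    qed
  qed
  then show ?thesis by (simp add: X h_def)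
qed

lemma pinv_D_mat_mvec: "A \<in> sym_mats \<Longrightarrow> pinv D_mat *v mvec A = vecs A"
  by (auto simp: vec_eq_iff pinv_D_mat_mult mvec_def vecs_def sym_mats_def transpose_def)

lemma sum_UNIV_prod: "(\<Sum>p\<in>UNIV. f p) = (\<Sum>a\<in>UNIV. \<Sum>b\<in>UNIV. f (a, b))"
  for f :: "'a::finite \<times> 'b::finite \<Rightarrow> real"
  by (simp add: sum.cartesian_product)

lemma kron_mvec: "kron B A *v mvec X = mvec (A ** X ** transpose B)"
  by (simp add: vec_eq_iff matrix_vector_mult_def kron_def mvec_def matrix_matrix_mult_def
      transpose_def sum_UNIV_prod sum_distrib_left sum_distrib_right mult_ac)

lemma mult_transpose_pinv_D_nth:
  "(A ** transpose (pinv D_mat)) $ i $ k = (A $ i $ (tri_col k, tri_row k) + A $ i $ (tri_row k, tri_col k)) / 2"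
  using pinv_D_mat_mult[of "A $ i" k]
  by (simp add: matrix_matrix_mult_def matrix_vector_mult_def transpose_def mult.commute)

lemma pinv_D_mult_nth:
  "(pinv D_mat ** A) $ k $ i = (A $ (tri_col k, tri_row k) $ i + A $ (tri_row k, tri_col k) $ i) / 2"
  using pinv_D_mat_mult[of "column i A" k]
  by (simp add: matrix_matrix_mult_def matrix_vector_mult_def column_def)

lemma M_mat_nth: "(A ** M_mat) $ p $ (a, b) = A $ p $ (b, a)"
proof -
  have *: "M_mat *v axis (a, b) 1 = axis (b, a) (1::real)"
  proof -
    have "M_mat *v axis (a, b) 1 = mvec (transpose (unmvec (axis (a, b) (1::real))))"
      using M_mat_mult[of "unmvec (axis (a, b) (1::real))"] by simp
    also have "\<dots> = axis (b, a) 1"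
      by (auto simp: mvec_def unmvec_def transpose_def axis_def vec_eq_iff)
    finally show ?thesis .
  qed
  have "(A ** M_mat) $ p $ (a, b) = ((A ** M_mat) *v axis (a, b) 1) $ p"
    by (simp add: matrix_vector_mult_basis column_def)
  also have "\<dots> = (A *v axis (b, a) 1) $ p"
    by (simp add: matrix_vector_mul_assoc[symmetric] *)
  finally show ?thesis by (simp add: matrix_vector_mult_basis column_def)
qed

lemma E_mu_nth:
  "E_mu \<mu> $ a $ k = (if a = tri_row k then \<mu> $ tri_col k else 0) + (if a = tri_col k then \<mu> $ tri_row k else 0)"
  unfolding E_mu_def mult_transpose_pinv_D_nth
  by (simp add: kron_def mat_def rowvector_def)

lemma guu0_nth: "guu0 \<Sigma> $ k $ l =
  (\<Sigma> $ tri_row k $ tri_row l * \<Sigma> $ tri_col k $ tri_col l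
 + \<Sigma> $ tri_row k $ tri_col l * \<Sigma> $ tri_col k $ tri_row l)"
  unfolding guu0_def mult_transpose_pinv_D_nth matrix_add_ldistrib M_mat_nth
  vector_add_component pinv_D_mult_nth matrix_mul_rid
  by (simp add: kron_def field_simps)

lemma matrix_inv_eqI:
  fixes A :: "real^'n^'n"
  assumes "A ** B = mat 1"
  shows "matrix_inv A = B"
proof -
  have BA: "B ** A = mat 1"
    using assms by (simp add: matrix_left_right_inverse)
  have "A ** matrix_inv A = mat 1 \<and> matrix_inv A ** A = mat 1"
    unfolding matrix_inv_def by (rule someI[of _ B]) (simp add: assms BA)
  then show ?thesis
    by (metis BA matrix_mul_assoc matrix_mul_lid matrix_mul_rid)
qed

lemma invertible_mult_matrix_inv:
  fixes A :: "real^'n^'n"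
  assumes "invertible A"
  shows "A ** matrix_inv A = mat 1" "matrix_inv A ** A = mat 1"
  using assms matrix_inv_eqI[of A] unfolding invertible_def by auto

lemma matrix_inv_mult_eqI:
  fixes A :: "real^'n^'n"
  assumes "invertible A" "A *v x = y"
  shows "matrix_inv A *v y = x"
  using assms by (auto simp: matrix_vector_mul_assoc invertible_mult_matrix_inv)

lemma K_mat_mult: "(K_mat *v v) $ k = (if tri_row k = tri_col k then 1 else 2) * v $ k"
  by (simp add: K_mat_def matrix_vector_mult_def if_distrib[of "\<lambda>x. x * _"] cong: if_cong)

lemma Kt_mat_mult: "(Kt_mat *v v) $ k = (if tri_row k = tri_col k then 1 / 2 else 1) * v $ k"
  by (simp add: Kt_mat_def matrix_vector_mult_def if_distrib[of "\<lambda>x. x * _"] cong: if_cong)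

lemma invertible_K_mat: "invertible (K_mat :: real^('n::{finite,wellorder} tri)^('n tri))"
proof -
  have "K_mat ** (\<chi> k l. if k = l then (if tri_row k = tri_col k then 1 else 1/2) else 0)
     = (mat 1 :: real^('n tri)^('n tri))"
    by (auto simp: K_mat_def matrix_matrix_mult_def mat_def vec_eq_iff if_distrib[of "\<lambda>x. x * _"] cong: if_cong)
  then show ?thesis
    using invertible_right_inverse by blast
qed

lemma matrix_inv_K_mat_mult: "(matrix_inv K_mat *v v) $ k = v $ k / (if tri_row k = tri_col k then 1 else 2)"
proof -
  have "matrix_inv K_mat *v v = (\<chi> k. v $ k / (if tri_row k = tri_col k then 1 else 2))"
    by (rule matrix_inv_mult_eqI[OF invertible_K_mat]) (simp add: vec_eq_iff K_mat_mult)
  then show ?thesis by simp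
qed

text \<open>
  An off-diagonal coordinate is spread evenly over its two mirror entries, which is what the factor
  \<open>K\<^sup>-\<^sup>1\<close> accounts for. This is where the matrix \<open>K\<close> of the natural parameters and the
  pseudo-inverse of the duplication matrix meet.
\<close>

lemma transpose_pinv_D_mat_mult:
  "transpose (pinv D_mat) *v v = mvec (symm_of (matrix_inv K_mat *v v))"
proof -
  have pd: "pinv D_mat $ k $ p = (axis p 1 $ (tri_col k, tri_row k) + axis p 1 $ (tri_row k, tri_col k)) / 2"
    for k :: "'a tri" and p
    using pinv_D_mat_mult[of "axis p 1" k] by (simp only: matrix_vector_mult_basis column_def vec_lambda_beta)
  have entry: "pinv D_mat $ k $ (a, b) = (if k = tri_of a b then if a = b then 1 else 1 / 2 else 0)"
    for k :: "'a tri" and a b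
    unfolding pd axis_def tri_eq_iff
    by (cases "tri_row k = a"; cases "tri_col k = b"; cases "tri_row k = b"; cases "tri_col k = a"; simp)
  have "(transpose (pinv D_mat) *v v) $ (a, b)
      = (\<Sum>k\<in>UNIV. if k = tri_of a b then (if a = b then 1 else 1 / 2) * v $ k else 0)" for a b
    unfolding matrix_vector_mult_def transpose_def entry vec_lambda_beta by (intro sum.cong) auto
  then have "(transpose (pinv D_mat) *v v) $ (a, b) = (if a = b then 1 else 1 / 2) * v $ tri_of a b" for a b
    by simp
  moreover have "mvec (symm_of (matrix_inv K_mat *v v)) $ (a, b) = (if a = b then 1 else 1 / 2) * v $ tri_of a b" for a b
  proof -
    have "max b a = min b a \<longleftrightarrow> a = b" by (auto simp: max_def min_def)
    then show ?thesis
      by (simp add: mvec_def symm_of_def matrix_inv_K_mat_mult tri_of_commute[of b a])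
  qed
  ultimately show ?thesis by (simp add: vec_eq_iff)
qed

lemma sym_mats_sandwich: "A \<in> sym_mats \<Longrightarrow> B ** A ** transpose B \<in> sym_mats"
  by (simp add: sym_mats_def matrix_transpose_mul matrix_mul_assoc)

text \<open>
  On symmetric matrices \<open>I + M\<close> is multiplication by 2, and \<open>\<Sigma> \<otimes> \<Sigma>\<close> is the map
  \<open>S \<mapsto> \<Sigma> S \<Sigma>\<close>; in this form the inverse of \<^const>\<open>guu0\<close> can be read off.
\<close>

lemma guu0_mult:
  assumes "\<Sigma> \<in> sym_mats"
  shows "guu0 \<Sigma> *v v = 2 *\<^sub>R vecs (\<Sigma> ** symm_of (matrix_inv K_mat *v v) ** \<Sigma>)"
proof -
  define S where "S = symm_of (matrix_inv K_mat *v v)"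
  have S: "transpose S = S" using symm_of_in S_def by (auto simp: sym_mats_def)
  have \<Sigma>: "transpose \<Sigma> = \<Sigma>" using assms by (simp add: sym_mats_def)
  have "guu0 \<Sigma> *v v = pinv D_mat *v (kron \<Sigma> \<Sigma> *v ((mat 1 + M_mat) *v mvec S))"
    by (simp add: guu0_def matrix_vector_mul_assoc[symmetric] transpose_pinv_D_mat_mult S_def del: transpose_matrix_vector)
  also have "(mat 1 + M_mat) *v mvec S = 2 *\<^sub>R mvec S"
    by (simp add: matrix_vector_mult_add_rdistrib M_mat_mult S scaleR_2)
  also have "pinv D_mat *v (kron \<Sigma> \<Sigma> *v (2 *\<^sub>R mvec S)) = 2 *\<^sub>R vecs (\<Sigma> ** S ** \<Sigma>)"
    using sym_mats_sandwich[of S \<Sigma>] S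
    by (simp add: matrix_vector_mult_scaleR kron_mvec pinv_D_mat_mvec \<Sigma> sym_mats_def)
  finally show ?thesis by (simp add: S_def)
qed

lemma invertible_guu0:
  assumes sym: "\<Sigma> \<in> sym_mats" and inv: "invertible \<Sigma>"
  shows "invertible (guu0 \<Sigma>)"
proof -
  define Q where "Q = matrix_inv \<Sigma>"
  have Q: "\<Sigma> ** Q = mat 1" "Q ** \<Sigma> = mat 1"
    using invertible_mult_matrix_inv[OF inv] by (simp_all add: Q_def)
  have \<Sigma>: "transpose \<Sigma> = \<Sigma>" using sym by (simp add: sym_mats_def)
  have Qt: "transpose Q = Q"
    by (metis Q \<Sigma> matrix_inv_eqI matrix_transpose_mul transpose_mat)
  have "\<exists>v. guu0 \<Sigma> *v v = w" for w
  proof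
    \<comment> \<open>The preimage solves \<open>2 \<Sigma> S \<Sigma> = W\<close> for \<open>S\<close>, up to the weights \<open>K\<close>.\<close>
    let ?v = "(1/2) *\<^sub>R (K_mat *v vecs (Q ** symm_of w ** Q))"
    have "matrix_inv K_mat *v ?v = (1/2) *\<^sub>R vecs (Q ** symm_of w ** Q)"
      by (rule matrix_inv_mult_eqI[OF invertible_K_mat]) (simp add: matrix_vector_mult_scaleR)
    then have "symm_of (matrix_inv K_mat *v ?v) = (1/2) *\<^sub>R (Q ** symm_of w ** Q)"
      using sym_mats_sandwich[OF symm_of_in, of Q w]
      by (simp add: linear_scale[OF linear_symm_of] Qt symm_of_vecs)
    then have "guu0 \<Sigma> *v ?v = 2 *\<^sub>R vecs (\<Sigma> ** ((1/2) *\<^sub>R (Q ** symm_of w ** Q)) ** \<Sigma>)"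
      by (simp add: guu0_mult[OF sym])
    also have "\<Sigma> ** ((1/2) *\<^sub>R (Q ** symm_of w ** Q)) ** \<Sigma> = (1/2) *\<^sub>R ((\<Sigma> ** Q) ** symm_of w ** (Q ** \<Sigma>))"
      by (simp add: matrix_mul_assoc matrix_scalar_ac scalar_matrix_assoc)
    finally show "guu0 \<Sigma> *v ?v = w"
      by (simp add: Q linear_scale[OF linear_vecs])
  qed
  then have "surj ((*v) (guu0 \<Sigma>))" by (metis surjI)
  then show ?thesis
    by (simp add: invertible_right_inverse matrix_right_invertible_surjective)
qed

section \<open>Inversion of a two-by-two block matrix\<close>

lemma stack_nth [simp]: "stack u v $ Inl i = u $ i" "stack u v $ Inr j = v $ j"
  by (simp_all add: stack_def)

lemma stack_eq_iff: "w = stack u v \<longleftrightarrow> (\<forall>i. w $ Inl i = u $ i) \<and> (\<forall>j. w $ Inr j = v $ j)"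
proof -
  have "(\<forall>s. w $ s = stack u v $ s) \<longleftrightarrow> (\<forall>i. w $ Inl i = u $ i) \<and> (\<forall>j. w $ Inr j = v $ j)"
    by (metis stack_nth sum.exhaust)
  then show ?thesis by (simp add: vec_eq_iff)
qed

lemma upper_block_stack [simp]: "upper_block (stack u v) = u"
  and lower_block_stack [simp]: "lower_block (stack u v) = v"
  by (simp_all add: upper_block_def lower_block_def vec_eq_iff)

lemma stack_blocks: "stack (upper_block w) (lower_block w) = w"
  unfolding eq_commute[of _ w] stack_eq_iff by (simp add: upper_block_def lower_block_def)

lemma sum_UNIV_Plus: "(\<Sum>s\<in>UNIV. f s) = (\<Sum>i\<in>UNIV. f (Inl i)) + (\<Sum>j\<in>UNIV. f (Inr j))"
  for f :: "'a::finite + 'b::finite \<Rightarrow> real"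
  using sum.Plus[of "UNIV :: 'a set" "UNIV :: 'b set" f] by (simp add: comp_def)

text \<open>
  \<open>G\<close> is the Schur complement of the block \<open>S\<close>: subtracting \<open>E\<^sup>T\<close> times the first block row from
  the second leaves \<open>G v = b - E\<^sup>T a\<close> for the lower unknown \<open>v\<close>. The same solution formula shows that
  \<open>F\<close> is onto, hence invertible.
\<close>

lemma block_matrix_inv:
  fixes F :: "real^('m::finite + 'k::finite)^('m + 'k)" and S :: "real^'m^'m" and E :: "real^'k^'m"
    and G :: "real^'k^'k"
  assumes ll: "\<And>i j. F $ Inl i $ Inl j = S $ i $ j"
    and lu: "\<And>i l. F $ Inl i $ Inr l = (S ** E) $ i $ l"
    and ul: "\<And>k j. F $ Inr k $ Inl j = (S ** E) $ j $ k"
    and uu: "\<And>k l. F $ Inr k $ Inr l = (G + transpose E ** S ** E) $ k $ l"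
    and symS: "transpose S = S" and invS: "invertible S" and invG: "invertible G"
  shows "matrix_inv F *v stack a b =
    stack (matrix_inv S *v a + E *v (matrix_inv G *v (transpose E *v a - b)))
          (matrix_inv G *v (b - transpose E *v a))"
proof -
  have mult: "F *v stack u v = stack (S *v u + S *v (E *v v))
      (transpose E *v (S *v u) + G *v v + transpose E *v (S *v (E *v v)))" for u v
  proof -
    have "transpose (S ** E) = transpose E ** S" by (simp add: matrix_transpose_mul symS)
    then have ul': "F $ Inr k $ Inl j = (transpose E ** S) $ k $ j" for k j
      using ul by (simp add: transpose_def vec_eq_iff)
    show ?thesis
      unfolding stack_eq_iff matrix_vector_mul_assoc matrix_mul_assoc
      by (simp add: matrix_vector_mult_def sum_UNIV_Plus ll lu ul' uu distrib_right sum.distrib)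
  qed
  let ?sol = "\<lambda>a b. stack (matrix_inv S *v a + E *v (matrix_inv G *v (transpose E *v a - b)))
          (matrix_inv G *v (b - transpose E *v a))"
  have SS: "S *v (matrix_inv S *v x) = x" for x
    by (simp add: matrix_vector_mul_assoc invertible_mult_matrix_inv[OF invS])
  have GG: "G *v (matrix_inv G *v x) = x" for x
    by (simp add: matrix_vector_mul_assoc invertible_mult_matrix_inv[OF invG])
  have sol: "F *v ?sol a b = stack a b" for a b
  proof -
    define v where "v = matrix_inv G *v (b - transpose E *v a)"
    have Gv: "G *v v = b - transpose E *v a" by (simp add: v_def GG)
    have v: "matrix_inv G *v (transpose E *v a - b) = - v"
      by (simp add: v_def matrix_vector_mult_diff_distrib)
    have "E *v (- v) = - (E *v v)"
      using matrix_vector_mult_diff_distrib[of E 0 v] by simp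
    then have u: "S *v (matrix_inv S *v a + E *v (- v)) = a - S *v (E *v v)"
      using matrix_vector_mult_diff_distrib[of S "matrix_inv S *v a" "E *v v"] by (simp add: SS)
    show ?thesis
      unfolding v unfolding v_def[symmetric] mult u
      by (simp add: Gv matrix_vector_mult_diff_distrib del: transpose_matrix_vector)
  qed
  have "\<exists>x. F *v x = w" for w
    using sol[of "upper_block w" "lower_block w"] stack_blocks by metis
  then have "surj ((*v) F)"
    unfolding surj_def by metis
  then have "invertible F"
    by (simp add: invertible_right_inverse matrix_right_invertible_surjective)
  then show ?thesis by (rule matrix_inv_mult_eqI) (rule sol)
qed

section \<open>Moments of Gaussian random variables\<close>

text \<open>
  The origin is left out of the hypothesis because this allows the induction step to divide the series
  by \<open>t\<close>.
\<close>

lemma powser_zero_coeffs: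
  fixes a :: "nat \<Rightarrow> real"
  assumes "\<And>t. t \<noteq> 0 \<Longrightarrow> (\<lambda>n. a n * t ^ n) sums 0"
  shows "a n = 0"
  using assms
proof (induction n arbitrary: a)
  case (0 a)
  have "((\<lambda>_. 0) \<longlongrightarrow> a 0) (at (0::real))"
    by (rule powser_limit_0_strong[of 1]) (use 0 in auto)
  then show ?case
    using tendsto_unique[OF _ tendsto_const[of 0]] by (metis at_neq_bot)
next
  case (Suc n a)
  have "((\<lambda>_. 0) \<longlongrightarrow> a 0) (at (0::real))"
    by (rule powser_limit_0_strong[of 1]) (use Suc.prems in auto)
  then have "a 0 = 0"
    using tendsto_unique[OF _ tendsto_const[of 0]] by (metis at_neq_bot)
  show ?case
  proof (rule Suc.IH[of "\<lambda>n. a (Suc n)"])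
    fix t :: real assume t: "t \<noteq> 0"
    have "(\<lambda>n. a (Suc n) * t ^ Suc n) sums 0"
      using Suc.prems[OF t] \<open>a 0 = 0\<close> by (subst sums_Suc_iff) simp
    then have "(\<lambda>n. (1 / t) * (a (Suc n) * t ^ Suc n)) sums ((1 / t) * 0)"
      by (rule sums_mult)
    then show "(\<lambda>n. a (Suc n) * t ^ n) sums 0" using t by (simp add: field_simps)
  qed
qed

text \<open>
  Since \<open>exp \<bar>t Y\<bar> \<le> exp (t Y) + exp (- t Y)\<close>, the exponential series may be integrated term by term,
  so the generating function is the power series with coefficients \<open>E Y\<^sup>n / n!\<close>. The
  moments then follow by comparing coefficients with the series of \<open>exp (t\<^sup>2 s / 2)\<close>.
\<close>

lemma moments_of_gaussian_mgf:
  fixes Y :: "'a \<Rightarrow> real"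
  assumes Y [measurable]: "Y \<in> borel_measurable M"
    and mgf: "\<And>t. has_bochner_integral M (\<lambda>x. exp (t * Y x)) (exp (t\<^sup>2 * s / 2))"
  shows "has_bochner_integral M (\<lambda>x. Y x ^ n)
    (if even n then fact n / fact (n div 2) * (s / 2) ^ (n div 2) else 0)"
proof -
  have exp_partial: "(\<Sum>n<N. \<bar>u\<bar> ^ n / fact n) \<le> exp u + exp (- u)" for u :: real and N
  proof -
    have "(\<Sum>n<N. \<bar>u\<bar> ^ n / fact n) \<le> (\<Sum>n. \<bar>u\<bar> ^ n / fact n)"
      using summable_exp[of "\<bar>u\<bar>"] by (intro sum_le_suminf) (auto simp: field_simps)
    also have "\<dots> = exp \<bar>u\<bar>" by (simp add: exp_def field_simps)
    also have "\<dots> \<le> exp u + exp (- u)" by (auto simp: abs_if)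
    finally show ?thesis .
  qed
  have exp_int: "integrable M (\<lambda>x. exp (t * Y x) + exp (- (t * Y x)))" for t
    using mgf[of t] mgf[of "- t"] by (auto simp: has_bochner_integral_iff)
  have pow_int: "integrable M (\<lambda>x. Y x ^ n)" for n
  proof (rule Bochner_Integration.integrable_bound)
    show "integrable M (\<lambda>x. fact n * (exp (1 * Y x) + exp (- (1 * Y x))))"
      using exp_int[of 1] by (intro integrable_mult_right) auto
    have "norm (Y x ^ n) \<le> norm (fact n * (exp (1 * Y x) + exp (- (1 * Y x))))" for x
    proof -
      have "\<bar>Y x\<bar> ^ n / fact n \<le> (\<Sum>n<Suc n. \<bar>Y x\<bar> ^ n / fact n)"
        by (simp add: sum_nonneg)
      also note exp_partial
      finally show ?thesis by (simp add: field_simps power_abs)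
    qed
    then show "AE x in M. norm (Y x ^ n) \<le> norm (fact n * (exp (1 * Y x) + exp (- (1 * Y x))))"
      by simp
  qed simp
  define m where "m n = (\<integral>x. Y x ^ n \<partial>M)" for n
  \<comment> \<open>The Taylor coefficients of \<open>exp (t\<^sup>2 s / 2)\<close>.\<close>
  define c where "c n = (if even n then (s / 2) ^ (n div 2) / fact (n div 2) else 0)" for n :: nat
  have "(\<lambda>n. (m n / fact n) * t ^ n) sums exp (t\<^sup>2 * s / 2)" for t
  proof -
    define f where "f = (\<lambda>n x. (t * Y x) ^ n / fact n)"
    have f_int: "integrable M (f n)" for n
      using pow_int[of n] by (simp add: f_def power_mult_distrib)
    have "(\<lambda>n. integral\<^sup>L M (f n)) sums (\<integral>x. (\<Sum>n. f n x) \<partial>M)"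
    proof (rule sums_integral[OF f_int])
      show "AE x in M. summable (\<lambda>n. norm (f n x))"
        using summable_norm_exp[of "t * Y _"] by (simp add: f_def divide_inverse mult.commute)
      show "summable (\<lambda>n. \<integral>x. norm (f n x) \<partial>M)"
      proof (rule summableI_nonneg_bounded)
        show "0 \<le> (\<integral>x. norm (f n x) \<partial>M)" for n by simp
        show "(\<Sum>n<N. \<integral>x. norm (f n x) \<partial>M) \<le> (\<integral>x. exp (t * Y x) + exp (- (t * Y x)) \<partial>M)" for N
        proof -
          have "(\<Sum>n<N. \<integral>x. norm (f n x) \<partial>M) = (\<integral>x. (\<Sum>n<N. norm (f n x)) \<partial>M)"
            by (rule Bochner_Integration.integral_sum[symmetric]) (simp add: f_int)
          also have "\<dots> \<le> (\<integral>x. exp (t * Y x) + exp (- (t * Y x)) \<partial>M)"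
          proof (rule integral_mono)
            show "integrable M (\<lambda>x. \<Sum>n<N. norm (f n x))" by (simp add: f_int)
            show "(\<Sum>n<N. norm (f n x)) \<le> exp (t * Y x) + exp (- (t * Y x))" for x
              using exp_partial[of "t * Y x" N] by (simp add: f_def power_abs abs_mult)
          qed (rule exp_int)
          finally show ?thesis .
        qed
      qed
    qed
    moreover have "(\<Sum>n. f n x) = exp (t * Y x)" for x
      by (simp add: f_def exp_def field_simps)
    moreover have "(\<integral>x. exp (t * Y x) \<partial>M) = exp (t\<^sup>2 * s / 2)"
      using mgf by (rule has_bochner_integral_integral_eq)
    moreover have "integral\<^sup>L M (f n) = (m n / fact n) * t ^ n" for n
      by (simp add: f_def m_def power_mult_distrib)
    ultimately show ?thesis by simp
  qed
  moreover have "(\<lambda>n. c n * t ^ n) sums exp (t\<^sup>2 * s / 2)" for t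
  proof -
    have "(\<lambda>k. (t\<^sup>2 * s / 2) ^ k / fact k) sums exp (t\<^sup>2 * s / 2)"
      using exp_converges[of "t\<^sup>2 * s / 2"] by (simp add: field_simps)
    moreover have "(t\<^sup>2 * s / 2) ^ k / fact k = c (2 * k) * t ^ (2 * k)" for k
    proof -
      have "(t\<^sup>2 * s / 2) ^ k = (s / 2) ^ k * (t\<^sup>2) ^ k" by (simp add: mult.commute flip: power_mult_distrib)
      then show ?thesis by (simp add: c_def power_mult)
    qed
    ultimately have "(\<lambda>k. c (2 * k) * t ^ (2 * k)) sums exp (t\<^sup>2 * s / 2)" by simp
    moreover have "c n * t ^ n = 0" if "n \<notin> range ((*) 2)" for n
    proof -
      have "odd n" using that by auto
      then show ?thesis by (simp add: c_def)
    qed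
    ultimately show ?thesis
      using sums_mono_reindex[of "(*) 2" "\<lambda>n. c n * t ^ n"] by (simp add: strict_mono_def)
  qed
  ultimately have "(\<lambda>n. (m n / fact n - c n) * t ^ n) sums 0" for t
    using sums_diff[of "\<lambda>n. (m n / fact n) * t ^ n" _ "\<lambda>n. c n * t ^ n"]
    by (fastforce simp: left_diff_distrib)
  then have "m n / fact n - c n = 0"
    by (rule powser_zero_coeffs)
  then have "m n = fact n * c n" by (simp add: field_simps)
  then show ?thesis
    using pow_int by (simp add: has_bochner_integral_iff m_def c_def)
qed

text \<open>
  The moments of all linear functionals determine the mixed moments by polarisation. Third and fourth
  powers are first polarised into \<open>u v\<^sup>2\<close> and \<open>u\<^sup>2 v\<^sup>2\<close>; after that the identity
  \<open>4 u v = (u + v)\<^sup>2 - (u - v)\<^sup>2\<close> separates one squared factor at a time. Proceeding in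
  this order keeps each polynomial identity small.
\<close>

lemma isserlis:
  fixes m :: "'a::real_inner" and Q :: "'a \<Rightarrow> 'a \<Rightarrow> real"
  assumes M: "\<And>n u. has_bochner_integral M (\<lambda>x. (u \<bullet> (x - m)) ^ n)
      (if even n then fact n / fact (n div 2) * (Q u u / 2) ^ (n div 2) else 0)"
    and add: "\<And>u v w. Q (u + v) w = Q u w + Q v w"
    and scale: "\<And>r u w. Q (r *\<^sub>R u) w = r * Q u w"
    and sym: "\<And>u v. Q u v = Q v u"
  shows "has_bochner_integral M (\<lambda>x. a \<bullet> (x - m)) 0"
    and "has_bochner_integral M (\<lambda>x. (a \<bullet> (x - m)) * (b \<bullet> (x - m))) (Q a b)"
    and "has_bochner_integral M (\<lambda>x. (a \<bullet> (x - m)) * (b \<bullet> (x - m)) * (c \<bullet> (x - m))) 0"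
    and "has_bochner_integral M (\<lambda>x. (a \<bullet> (x - m)) * (b \<bullet> (x - m)) * (c \<bullet> (x - m)) * (d \<bullet> (x - m)))
      (Q a b * Q c d + Q a c * Q b d + Q a d * Q b c)"
proof -
  define y where "y u x = u \<bullet> (x - m)" for u x
  have y_add: "y (u + v) x = y u x + y v x" and y_diff: "y (u - v) x = y u x - y v x" for u v x
    by (simp_all add: y_def inner_add_left inner_diff_left)
  have Q_diff: "Q (u - v) w = Q u w - Q v w" for u v w
    using add[of u "- v" w] scale[of "-1" v w] by simp
  have Q_add': "Q w (u + v) = Q w u + Q w v" and Q_diff': "Q w (u - v) = Q w u - Q w v" for u v w
    using add[of u v w] Q_diff[of u v w] by (simp_all add: sym[of w])
  note bilin = add Q_diff Q_add' Q_diff' y_add y_diff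
  show "has_bochner_integral M (\<lambda>x. a \<bullet> (x - m)) 0"
    using M[of a 1] by simp
  have 2: "has_bochner_integral M (\<lambda>x. y u x ^ 2) (Q u u)" for u
    using M[of u 2] by (simp add: y_def)
  have 3: "has_bochner_integral M (\<lambda>x. y u x ^ 3) 0" for u
    using M[of u 3] by (simp add: y_def)
  have 4: "has_bochner_integral M (\<lambda>x. y u x ^ 4) (3 * (Q u u)^2)" for u
    using M[of u 4] by (simp add: y_def fact_numeral power2_eq_square)
  have polar: "has_bochner_integral M (\<lambda>x. g x * y u x * y v x) r"
    if "has_bochner_integral M (\<lambda>x. g x * y (u + v) x ^ 2) p"
       "has_bochner_integral M (\<lambda>x. g x * y (u - v) x ^ 2) q" "p - q = 4 * r" for g u v p q r
  proof -
    have "has_bochner_integral M (\<lambda>x. (g x * y (u + v) x ^ 2 - g x * y (u - v) x ^ 2) / 4) ((p - q) / 4)"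
      by (intro has_bochner_integral_divide_zero has_bochner_integral_diff that(1,2))
    moreover have "(g x * y (u + v) x ^ 2 - g x * y (u - v) x ^ 2) / 4 = g x * y u x * y v x" for x
      by (simp add: y_add y_diff power2_eq_square algebra_simps)
    ultimately show ?thesis using that(3) by simp
  qed
  show "has_bochner_integral M (\<lambda>x. (a \<bullet> (x - m)) * (b \<bullet> (x - m))) (Q a b)"
    using polar[of "\<lambda>_. 1" a b _ _ "Q a b"] 2[of "a + b"] 2[of "a - b"]
    by (simp add: bilin sym[of b a] flip: y_def)
  have 21: "has_bochner_integral M (\<lambda>x. y u x * y v x ^ 2) 0" for u v
  proof -
    have "has_bochner_integral M (\<lambda>x. (y (u + v) x ^ 3 + y (u - v) x ^ 3 - 2 * y u x ^ 3) / 6) ((0 + 0 - 2 * 0) / 6)"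
      by (intro has_bochner_integral_divide_zero has_bochner_integral_diff has_bochner_integral_add
          has_bochner_integral_mult_right 3)
    moreover have "(y (u + v) x ^ 3 + y (u - v) x ^ 3 - 2 * y u x ^ 3) / 6 = y u x * y v x ^ 2" for x
      by (simp add: y_add y_diff power3_eq_cube power2_eq_square algebra_simps)
    ultimately show ?thesis by simp
  qed
  show "has_bochner_integral M (\<lambda>x. (a \<bullet> (x - m)) * (b \<bullet> (x - m)) * (c \<bullet> (x - m))) 0"
    using polar[of "y a" b c 0 0 0] 21[of a "b + c"] 21[of a "b - c"] by (simp flip: y_def)
  have 22: "has_bochner_integral M (\<lambda>x. y u x ^ 2 * y v x ^ 2) (Q u u * Q v v + 2 * (Q u v)^2)" for u v
  proof -
    have "has_bochner_integral M (\<lambda>x. (y (u + v) x ^ 4 + y (u - v) x ^ 4 - 2 * y u x ^ 4 - 2 * y v x ^ 4) / 12)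
       ((3 * (Q (u + v) (u + v))^2 + 3 * (Q (u - v) (u - v))^2 - 2 * (3 * (Q u u)^2) - 2 * (3 * (Q v v)^2)) / 12)"
      by (intro has_bochner_integral_divide_zero has_bochner_integral_diff has_bochner_integral_add
          has_bochner_integral_mult_right 4)
    moreover have "(y (u + v) x ^ 4 + y (u - v) x ^ 4 - 2 * y u x ^ 4 - 2 * y v x ^ 4) / 12 = y u x ^ 2 * y v x ^ 2" for x
      by (simp add: y_add y_diff power4_eq_xxxx power2_eq_square algebra_simps)
    moreover have "(3 * (Q (u + v) (u + v))^2 + 3 * (Q (u - v) (u - v))^2 - 2 * (3 * (Q u u)^2) - 2 * (3 * (Q v v)^2)) / 12
       = Q u u * Q v v + 2 * (Q u v)^2"
      by (simp add: bilin sym[of v u] power2_eq_square algebra_simps)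
    ultimately show ?thesis by (simp only:)
  qed
  have 211: "has_bochner_integral M (\<lambda>x. y w x ^ 2 * y u x * y v x) (Q w w * Q u v + 2 * Q w u * Q w v)" for u v w
    by (rule polar[OF 22 22]) (simp add: bilin sym[of v u] power2_eq_square algebra_simps)
  have 112: "has_bochner_integral M (\<lambda>x. y u x * y v x * y w x ^ 2) (Q w w * Q u v + 2 * Q w u * Q w v)" for u v w
    using 211[of w u v] by (simp add: mult_ac)
  show "has_bochner_integral M (\<lambda>x. (a \<bullet> (x - m)) * (b \<bullet> (x - m)) * (c \<bullet> (x - m)) * (d \<bullet> (x - m)))
      (Q a b * Q c d + Q a c * Q b d + Q a d * Q b c)"
    unfolding y_def[symmetric]
    by (rule polar[OF 112 112]) (simp add: bilin sym[of d c] sym[of c a] sym[of c b] sym[of d a] sym[of d b] algebra_simps)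
qed

section \<open>Gaussian integrals\<close>

text \<open>
  The quadratic form attains a positive minimum on the compact unit sphere, and it is homogeneous.
\<close>

lemma spd_coercive:
  fixes P :: "real^'n^'n"
  assumes "P \<in> spd_mats"
  obtains c where "c > 0" "\<And>x. c * (x \<bullet> x) \<le> x \<bullet> (P *v x)"
proof -
  have "\<exists>x\<in>sphere (0::real^'n) 1. \<forall>y\<in>sphere 0 1. x \<bullet> (P *v x) \<le> y \<bullet> (P *v y)"
  proof (rule continuous_attains_inf)
    have "axis undefined 1 \<in> sphere (0::real^'n) 1" by simp
    then show "sphere (0::real^'n) 1 \<noteq> {}" by blast
  qed (auto intro!: continuous_intros matrix_vector_mult_linear_continuous_on)
  then obtain u where u: "norm u = 1" "\<And>y. norm y = 1 \<Longrightarrow> u \<bullet> (P *v u) \<le> y \<bullet> (P *v y)" by auto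
  have "u \<noteq> 0" using u by auto
  then have "0 < u \<bullet> (P *v u)" using assms by (auto simp: spd_mats_def)
  moreover have "u \<bullet> (P *v u) * (x \<bullet> x) \<le> x \<bullet> (P *v x)" for x
  proof (cases "x = 0")
    case False
    have "u \<bullet> (P *v u) \<le> (x /\<^sub>R norm x) \<bullet> (P *v (x /\<^sub>R norm x))"
      using False by (intro u) simp
    also have "\<dots> = x \<bullet> (P *v x) / (norm x)\<^sup>2"
      by (simp add: matrix_vector_mult_scaleR power2_eq_square divide_inverse)
    finally show ?thesis
      using False by (simp add: field_simps dot_square_norm)
  qed simp
  ultimately show ?thesis using that by blast
qed

text \<open>
  Lebesgue measure is a product measure and the integrand is a product of one-dimensional normal
  densities, up to constants.
\<close>

lemma integrable_exp_neg_inner: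
  assumes "c > 0"
  shows "integrable lborel (\<lambda>x::'a::euclidean_space. exp (- (c * (x \<bullet> x))))"
proof -
  interpret product_sigma_finite "\<lambda>_::'a. lborel :: real measure" by standard
  \<comment> \<open>The standard deviation whose normal density is proportional to \<open>exp (- c t\<^sup>2)\<close>.\<close>
  define \<sigma> where "\<sigma> = 1 / sqrt (2 * c)"
  have \<sigma>: "2 * \<sigma>\<^sup>2 = 1 / c" "\<sigma> > 0" using assms by (simp_all add: \<sigma>_def power_divide)
  have "integrable lborel (\<lambda>t. sqrt (2 * pi * \<sigma>\<^sup>2) * normal_density 0 \<sigma> t)"
    by (intro integrable_mult_right integrable_normal_density \<sigma>)
  moreover have "sqrt (2 * pi * \<sigma>\<^sup>2) * normal_density 0 \<sigma> t = exp (- (c * t\<^sup>2))" for t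
  proof -
    have "t\<^sup>2 / (2 * \<sigma>\<^sup>2) = c * t\<^sup>2" using assms by (simp add: \<sigma>)
    then show ?thesis using \<sigma>(2) by (simp add: normal_density_def)
  qed
  ultimately have one: "integrable lborel (\<lambda>t::real. exp (- (c * t\<^sup>2)))" by simp
  have "integrable (\<Pi>\<^sub>M b\<in>(Basis::'a set). lborel) (\<lambda>f. \<Prod>b\<in>(Basis::'a set). exp (- (c * (f b)\<^sup>2)))"
    by (rule product_integrable_prod) (auto intro: one)
  moreover have "exp (- (c * (x \<bullet> x))) = (\<Prod>b\<in>(Basis::'a set). exp (- (c * (f b)\<^sup>2)))"
    if "x = (\<Sum>b\<in>Basis. f b *\<^sub>R b)" for x :: 'a and f
  proof -
    have "x \<bullet> x = (\<Sum>b\<in>Basis. (f b)\<^sup>2)"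
    proof -
      have "x \<bullet> b = f b" if "b \<in> Basis" for b
        using that \<open>x = _\<close> by (simp add: inner_sum_left inner_Basis if_distrib cong: if_cong)
      then show ?thesis by (subst euclidean_inner) (simp add: power2_eq_square)
    qed
    then show ?thesis by (simp add: exp_sum[symmetric] sum_distrib_left sum_negf)
  qed
  ultimately show ?thesis
    by (subst lborel_eq, subst integrable_distr_eq) simp_all
qed

lemma has_bochner_integral_lborel_translate:
  fixes f :: "'a::euclidean_space \<Rightarrow> real"
  assumes "has_bochner_integral lborel f v"
  shows "has_bochner_integral lborel (\<lambda>x. f (x - a)) v"
proof -
  have [measurable]: "f \<in> borel_measurable borel"
    using borel_measurable_has_bochner_integral[OF assms] by simp
  have T: "(+) (- a) \<in> measurable lborel borel" by simp
  have "has_bochner_integral (distr lborel borel ((+) (- a))) f v"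
    unfolding lborel_distr_plus by (rule assms)
  then have "has_bochner_integral lborel (\<lambda>x. f (- a + x)) v"
    using integrable_distr_eq[OF T, of f] integral_distr[OF T, of f] by (simp add: has_bochner_integral_iff)
  then show ?thesis by simp
qed

lemma sym_matrix_inner:
  fixes A :: "real^'n^'n"
  assumes "transpose A = A"
  shows "x \<bullet> (A *v y) = (A *v x) \<bullet> y"
  using dot_lmul_matrix[of x A y] assms by (metis transpose_matrix_vector)

lemma complete_square:
  fixes P :: "real^'n^'n"
  assumes "transpose P = P" "w = 2 *\<^sub>R (P *v m)"
  shows "w \<bullet> x - x \<bullet> (P *v x) = - ((x - m) \<bullet> (P *v (x - m))) + (w \<bullet> m) / 2"
proof -
  have "m \<bullet> (P *v x) = (P *v m) \<bullet> x" by (rule sym_matrix_inner) fact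
  then show ?thesis
    by (simp add: assms(2) algebra_simps inner_diff_right inner_commute)
qed

lemma
  fixes P :: "real^'n^'n"
  assumes P: "P \<in> spd_mats"
  shows gaussian_integrable: "integrable lborel (\<lambda>x. exp (- (x \<bullet> (P *v x))))"
    and gaussian_integral_pos: "0 < (LINT x|lborel. exp (- (x \<bullet> (P *v x))))"
proof -
  have "continuous_on UNIV (\<lambda>x. exp (- (x \<bullet> (P *v x))))"
    by (intro continuous_intros matrix_vector_mult_linear_continuous_on)
  then have [measurable]: "(\<lambda>x. exp (- (x \<bullet> (P *v x)))) \<in> borel_measurable borel"
    by (rule borel_measurable_continuous_onI)
  obtain c where c: "c > 0" "\<And>x. c * (x \<bullet> x) \<le> x \<bullet> (P *v x)" using spd_coercive[OF P] by blast
  show int: "integrable lborel (\<lambda>x. exp (- (x \<bullet> (P *v x))))"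
    by (rule Bochner_Integration.integrable_bound[OF integrable_exp_neg_inner[OF c(1)]]) (use c in auto)
  have "(LINT x|lborel. exp (- (x \<bullet> (P *v x)))) \<noteq> 0"
  proof
    assume "(LINT x|lborel. exp (- (x \<bullet> (P *v x)))) = 0"
    then have "AE x in (lborel :: (real^'n) measure). exp (- (x \<bullet> (P *v x))) = 0"
      using integral_nonneg_eq_0_iff_AE[OF int] by simp
    then have "AE x in (lborel :: (real^'n) measure). False" by simp
    then show False by (simp add: AE_iff_null null_sets_def)
  qed
  moreover have "0 \<le> (LINT x|lborel. exp (- (x \<bullet> (P *v x))))" by simp
  ultimately show "0 < (LINT x|lborel. exp (- (x \<bullet> (P *v x))))" by linarith
qed

text \<open>
  Completing the square turns the exponential tilt by \<open>w\<close> into a translation by \<open>m\<close>, which Lebesgue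
  measure does not see.
\<close>

lemma gaussian_laplace:
  fixes P :: "real^'n^'n"
  assumes P: "P \<in> spd_mats" and w: "w = 2 *\<^sub>R (P *v m)"
  shows "has_bochner_integral lborel (\<lambda>x. exp (w \<bullet> x - x \<bullet> (P *v x)))
    (exp (w \<bullet> m / 2) * (LINT x|lborel. exp (- (x \<bullet> (P *v x)))))"
proof -
  have "has_bochner_integral lborel (\<lambda>x. exp (- (x \<bullet> (P *v x)))) (LINT x|lborel. exp (- (x \<bullet> (P *v x))))"
    using gaussian_integrable[OF P] by (rule has_bochner_integral_integrable)
  then have "has_bochner_integral lborel (\<lambda>x. exp (w \<bullet> m / 2) * exp (- ((x - m) \<bullet> (P *v (x - m)))))
    (exp (w \<bullet> m / 2) * (LINT x|lborel. exp (- (x \<bullet> (P *v x)))))"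
    by (intro has_bochner_integral_mult_right has_bochner_integral_lborel_translate)
  moreover have "exp (w \<bullet> m / 2) * exp (- ((x - m) \<bullet> (P *v (x - m)))) = exp (w \<bullet> x - x \<bullet> (P *v x))" for x
    using complete_square[of P w m x] P w by (simp add: spd_mats_def exp_add[symmetric])
  ultimately show ?thesis by simp
qed

lemma has_bochner_integral_vec:
  fixes f :: "'a \<Rightarrow> real^'n"
  assumes "\<And>i. has_bochner_integral M (\<lambda>x. f x $ i) (v $ i)"
  shows "has_bochner_integral M f v"
proof -
  have "has_bochner_integral M (\<lambda>x. \<Sum>i\<in>UNIV. f x $ i *\<^sub>R axis i (1::real)) (\<Sum>i\<in>UNIV. v $ i *\<^sub>R axis i 1)"
    by (intro has_bochner_integral_sum has_bochner_integral_scaleR_left assms)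
  then show ?thesis by (simp add: basis_expansion flip: scalar_mult_eq_scaleR)
qed

section \<open>The Fisher information of the Gaussian family\<close>

text \<open>
  The weight 2 of the off-diagonal coordinates in \<^const>\<open>K_mat\<close> makes the half-vectorised inner product
  equal to the Frobenius inner product.
\<close>

lemma vecs_inner_K_mat:
  assumes "A \<in> sym_mats" "B \<in> sym_mats"
  shows "vecs A \<bullet> (K_mat *v vecs B) = (\<Sum>i\<in>UNIV. \<Sum>j\<in>UNIV. A $ i $ j * B $ i $ j)"
proof -
  have KK: "matrix_inv K_mat *v (K_mat *v vecs B) = vecs B"
    by (rule matrix_inv_mult_eqI[OF invertible_K_mat]) simp
  have "vecs A \<bullet> (K_mat *v vecs B) = (pinv D_mat *v mvec A) \<bullet> (K_mat *v vecs B)"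
    by (simp add: pinv_D_mat_mvec assms)
  also have "\<dots> = mvec A \<bullet> (transpose (pinv D_mat) *v (K_mat *v vecs B))"
    using dot_lmul_matrix[of "K_mat *v vecs B" "pinv D_mat" "mvec A"] by (simp add: inner_commute)
  also have "\<dots> = mvec A \<bullet> mvec B"
    by (simp add: transpose_pinv_D_mat_mult KK symm_of_vecs assms del: transpose_matrix_vector)
  also have "\<dots> = (\<Sum>i\<in>UNIV. \<Sum>j\<in>UNIV. A $ j $ i * B $ j $ i)"
    by (simp add: inner_vec_def sum_UNIV_prod mvec_def)
  finally show ?thesis by (subst sum.swap)
qed

lemma c_stat_inner:
  assumes "P \<in> sym_mats"
  shows "c_stat x \<bullet> stack a (- (K_mat *v vecs P)) = a \<bullet> x - x \<bullet> (P *v x)"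
proof -
  let ?X = "\<chi> i j. x $ i * x $ j"
  have "c_stat x \<bullet> stack a (- (K_mat *v vecs P)) = x \<bullet> a + c_u x \<bullet> (- (K_mat *v vecs P))"
    by (simp add: inner_vec_def sum_UNIV_Plus c_stat_def c_l_def)
  also have "c_u x \<bullet> (- (K_mat *v vecs P)) = - (vecs ?X \<bullet> (K_mat *v vecs P))"
    by (simp add: c_u_def)
  also have "?X \<in> sym_mats" by (simp add: sym_mats_def transpose_def vec_eq_iff mult.commute)
  then have "vecs ?X \<bullet> (K_mat *v vecs P) = (\<Sum>i\<in>UNIV. \<Sum>j\<in>UNIV. x $ i * x $ j * P $ i $ j)"
    by (simp add: vecs_inner_K_mat assms)
  also have "\<dots> = x \<bullet> (P *v x)"
    by (simp add: inner_vec_def matrix_vector_mult_def sum_distrib_left mult_ac)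
  finally show ?thesis by (simp add: inner_commute)
qed

text \<open>
  The Gaussian with first natural parameter \<open>a\<close> and second parameter encoding the matrix \<open>P\<close>, which is
  half the inverse of the covariance \<open>\<Sigma>\<close>. That \<open>m\<close> and \<open>\<Sigma>\<close> are the mean and the covariance is
  proved in \<open>mean_of_eq\<close> and \<open>cov_of_eq\<close>.
\<close>

locale gaussian =
  fixes P :: "real^'n::{finite,wellorder}^'n::_" and a :: "real^'n::_"
  assumes spd: "P \<in> spd_mats"
begin

definition "\<theta> = stack a (- (K_mat *v vecs P))"
definition "\<Sigma> = matrix_inv (2 *\<^sub>R P)"
definition "m = \<Sigma> *v a"
definition "Z = (LINT x|lborel. exp (- (x \<bullet> (P *v x))))"
abbreviation "law \<equiv> density lborel (p_dens \<theta>)"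

lemma P_sym: "transpose P = P" using spd by (simp add: spd_mats_def)

lemma invertible_precision: "invertible (2 *\<^sub>R P)"
proof -
  have "P *v x = 0 \<Longrightarrow> x = 0" for x
    using spd by (cases "x = 0") (auto simp: spd_mats_def dest: spec[of _ x])
  then have "inj ((*v) P)"
    by (intro injI) (metis eq_iff_diff_eq_0 matrix_vector_mult_diff_distrib)
  then have "invertible P"
    by (simp add: invertible_left_inverse matrix_left_invertible_injective)
  then show ?thesis by (simp add: scalar_invertible_iff)
qed

lemma \<Sigma>_inverse: "(2 *\<^sub>R P) ** \<Sigma> = mat 1" "\<Sigma> ** (2 *\<^sub>R P) = mat 1"
  unfolding \<Sigma>_def by (rule invertible_mult_matrix_inv[OF invertible_precision])+

lemma invertible_\<Sigma>: "invertible \<Sigma>" using \<Sigma>_inverse unfolding invertible_def by blast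

lemma matrix_inv_\<Sigma>: "matrix_inv \<Sigma> = 2 *\<^sub>R P" using \<Sigma>_inverse(2) by (rule matrix_inv_eqI)

lemma \<Sigma>_sym: "transpose \<Sigma> = \<Sigma>"
proof -
  have "transpose (2 *\<^sub>R P) = 2 *\<^sub>R P"
    using P_sym by (simp add: transpose_scalar)
  then have "(2 *\<^sub>R P) ** transpose \<Sigma> = mat 1"
    using \<Sigma>_inverse(2) by (metis matrix_transpose_mul transpose_mat)
  then show ?thesis unfolding \<Sigma>_def by (metis matrix_inv_eqI)
qed

lemma \<Sigma>_solves: "w = 2 *\<^sub>R (P *v (\<Sigma> *v w))"
proof -
  have "((2 *\<^sub>R P) ** \<Sigma>) *v w = w" by (simp add: \<Sigma>_inverse)
  then show ?thesis by (simp add: matrix_vector_mul_assoc[symmetric] scaleR_matrix_vector_assoc)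
qed

lemma Z_pos: "0 < Z" unfolding Z_def by (rule gaussian_integral_pos[OF spd])

text \<open>
  The log-partition function takes up the constant of the completed square, so the density depends on
  \<open>x - m\<close> only.
\<close>

lemma p_dens_eq: "p_dens \<theta> x = exp (- ((x - m) \<bullet> (P *v (x - m)))) / Z"
proof -
  have c: "c_stat x \<bullet> \<theta> = a \<bullet> x - x \<bullet> (P *v x)" for x
    unfolding \<theta>_def using P_sym by (simp add: c_stat_inner sym_mats_def)
  have "(LINT x|lborel. exp (c_stat x \<bullet> \<theta>)) = exp (a \<bullet> m / 2) * Z"
    unfolding c Z_def m_def
    by (rule has_bochner_integral_integral_eq) (rule gaussian_laplace[OF spd \<Sigma>_solves])
  then have "exp (psi \<theta>) = exp (a \<bullet> m / 2) * Z"
    unfolding psi_def using Z_pos by (simp add: exp_ln)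
  then have "p_dens \<theta> x = exp (a \<bullet> x - x \<bullet> (P *v x)) / (exp (a \<bullet> m / 2) * Z)"
    by (simp add: p_dens_def c exp_diff)
  also have "a \<bullet> x - x \<bullet> (P *v x) = - ((x - m) \<bullet> (P *v (x - m))) + a \<bullet> m / 2"
    unfolding m_def by (rule complete_square[OF P_sym \<Sigma>_solves])
  finally show ?thesis by (simp only: exp_add) simp
qed

lemma p_dens_nonneg: "0 \<le> p_dens \<theta> x"
  using Z_pos by (simp add: p_dens_eq)

lemma p_dens_measurable [measurable]: "p_dens \<theta> \<in> borel_measurable borel"
proof -
  have "continuous_on UNIV (\<lambda>x. exp (- ((x - m) \<bullet> (P *v (x - m)))) / Z)"
    using Z_pos by (intro continuous_intros
      continuous_on_compose2[OF matrix_vector_mult_linear_continuous_on[of UNIV P]]) auto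
  then have "(\<lambda>x. p_dens \<theta> x) \<in> borel_measurable borel"
    unfolding p_dens_eq by (rule borel_measurable_continuous_onI)
  then show ?thesis by simp
qed

lemma expect_eq:
  assumes "has_bochner_integral law \<phi> v"
  shows "expect \<theta> \<phi> = v"
proof -
  have "\<phi> \<in> borel_measurable lborel"
    using borel_measurable_has_bochner_integral[OF assms] by simp
  moreover have "p_dens \<theta> \<in> borel_measurable lborel" by simp
  moreover have "AE x in lborel. 0 \<le> p_dens \<theta> x" by (simp add: p_dens_nonneg)
  ultimately have "integral\<^sup>L law \<phi> = expect \<theta> \<phi>"
    unfolding expect_def by (rule integral_density)
  then show ?thesis using has_bochner_integral_integral_eq[OF assms] by simp
qed

text \<open>
  Tilting the centred Gaussian by \<open>t u\<close> shifts it by \<open>t \<Sigma> u\<close>, and the completed square contributes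
  \<open>t\<^sup>2 u \<bullet> \<Sigma> u / 2\<close>.
\<close>

lemma mgf:
  "has_bochner_integral law (\<lambda>x. exp (t * (u \<bullet> (x - m)))) (exp (t\<^sup>2 * (u \<bullet> (\<Sigma> *v u)) / 2))"
proof (rule has_bochner_integral_density)
  have "has_bochner_integral lborel (\<lambda>x. exp ((t *\<^sub>R u) \<bullet> x - x \<bullet> (P *v x)))
    (exp ((t *\<^sub>R u) \<bullet> (\<Sigma> *v (t *\<^sub>R u)) / 2) * Z)"
    unfolding Z_def by (rule gaussian_laplace[OF spd \<Sigma>_solves])
  from has_bochner_integral_divide_zero[OF has_bochner_integral_lborel_translate[OF this, of m], of Z]
  have "has_bochner_integral lborel (\<lambda>x. exp (t * (u \<bullet> (x - m)) - (x - m) \<bullet> (P *v (x - m))) / Z)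
    (exp (t\<^sup>2 * (u \<bullet> (\<Sigma> *v u)) / 2))"
    using Z_pos by (simp add: matrix_vector_mult_scaleR power2_eq_square mult.assoc)
  moreover have "exp (t * (u \<bullet> (x - m)) - (x - m) \<bullet> (P *v (x - m))) / Z
    = p_dens \<theta> x *\<^sub>R exp (t * (u \<bullet> (x - m)))" for x
    by (simp add: p_dens_eq exp_diff exp_minus field_simps)
  ultimately show "has_bochner_integral lborel (\<lambda>x. p_dens \<theta> x *\<^sub>R exp (t * (u \<bullet> (x - m))))
    (exp (t\<^sup>2 * (u \<bullet> (\<Sigma> *v u)) / 2))" by simp
qed (auto simp: p_dens_nonneg)

lemma moments:
  "has_bochner_integral law (\<lambda>x. (u \<bullet> (x - m)) ^ n)
      (if even n then fact n / fact (n div 2) * ((u \<bullet> (\<Sigma> *v u)) / 2) ^ (n div 2) else 0)"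
  by (rule moments_of_gaussian_mgf[OF _ mgf]) simp

definition "dev i x = (x - m) $ i"

lemma
  shows moment0: "has_bochner_integral law (\<lambda>x. 1::real) 1"
    and moment1: "has_bochner_integral law (dev i) 0"
    and moment2: "has_bochner_integral law (\<lambda>x. dev i x * dev j x) (\<Sigma> $ i $ j)"
    and moment3: "has_bochner_integral law (\<lambda>x. dev i x * dev j x * dev k x) 0"
    and moment4: "has_bochner_integral law (\<lambda>x. dev i x * dev j x * dev k x * dev l x)
      (\<Sigma> $ i $ j * \<Sigma> $ k $ l + \<Sigma> $ i $ k * \<Sigma> $ j $ l + \<Sigma> $ i $ l * \<Sigma> $ j $ k)"
proof -
  show "has_bochner_integral law (\<lambda>x. 1::real) 1"
    using moments[of 0 0] by simp
  have dev: "dev i = (\<lambda>x. axis i 1 \<bullet> (x - m))" for i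
    by (simp add: dev_def fun_eq_iff inner_axis inner_commute[of "axis i 1"])
  have Q: "axis i 1 \<bullet> (\<Sigma> *v axis j 1) = \<Sigma> $ i $ j" for i j
    by (simp add: matrix_vector_mult_basis column_def inner_axis inner_commute[of "axis i 1"])
  have sym: "u \<bullet> (\<Sigma> *v v) = v \<bullet> (\<Sigma> *v u)" for u v
    using sym_matrix_inner[OF \<Sigma>_sym, of u v] by (simp add: inner_commute)
  have *: "(u + v) \<bullet> (\<Sigma> *v w) = u \<bullet> (\<Sigma> *v w) + v \<bullet> (\<Sigma> *v w)"
       "(r *\<^sub>R u) \<bullet> (\<Sigma> *v w) = r * (u \<bullet> (\<Sigma> *v w))" for u v w r
    by (simp_all add: inner_add_left)
  note W = isserlis[where Q = "\<lambda>u v. u \<bullet> (\<Sigma> *v v)", OF moments * sym]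
  show "has_bochner_integral law (dev i) 0"
    and "has_bochner_integral law (\<lambda>x. dev i x * dev j x) (\<Sigma> $ i $ j)"
    and "has_bochner_integral law (\<lambda>x. dev i x * dev j x * dev k x) 0"
    and "has_bochner_integral law (\<lambda>x. dev i x * dev j x * dev k x * dev l x)
      (\<Sigma> $ i $ j * \<Sigma> $ k $ l + \<Sigma> $ i $ k * \<Sigma> $ j $ l + \<Sigma> $ i $ l * \<Sigma> $ j $ k)"
    using W(1)[of "axis i 1"] W(2)[of "axis i 1" "axis j 1"] W(3)[of "axis i 1" "axis j 1" "axis k 1"]
      W(4)[of "axis i 1" "axis j 1" "axis k 1" "axis l 1"]
    unfolding dev Q by simp_all
qed

lemma mean_of_eq: "mean_of \<theta> = m"
proof -
  have "has_bochner_integral law (\<lambda>x. x) m"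
  proof (rule has_bochner_integral_vec)
    fix i
    have "has_bochner_integral law (\<lambda>x. dev i x + m $ i * 1) (0 + m $ i * 1)"
      by (intro has_bochner_integral_add has_bochner_integral_mult_right moment0 moment1)
    then show "has_bochner_integral law (\<lambda>x. x $ i) (m $ i)" by (simp add: dev_def)
  qed
  then show ?thesis unfolding mean_of_def by (rule expect_eq)
qed

lemma cov_of_eq: "cov_of \<theta> = \<Sigma>"
  unfolding cov_of_def covar_def mean_of_def[symmetric] mean_of_eq
  using expect_eq[OF moment2] by (simp add: vec_eq_iff dev_def)

text \<open>
  The centred quadratic statistic \<open>x\<^sub>r x\<^sub>c - E (x\<^sub>r x\<^sub>c)\<close>, written in terms of the deviations from the
  mean: a linear part and a centred quadratic part. The factor 1 is the integrand whose
  moment is the total mass.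
\<close>

definition "dev_u k x = m $ tri_row k * dev (tri_col k) x + m $ tri_col k * dev (tri_row k) x
   + (dev (tri_row k) x * dev (tri_col k) x - \<Sigma> $ tri_row k $ tri_col k * 1)"

definition "mean_stat = stack m (vecs (\<chi> i j. m $ i * m $ j + \<Sigma> $ i $ j))"

lemma c_stat_centred: "c_stat x $ Inl i - mean_stat $ Inl i = dev i x" "c_stat x $ Inr k - mean_stat $ Inr k = dev_u k x"
  by (simp_all add: c_stat_def c_l_def c_u_def mean_stat_def vecs_def dev_u_def dev_def algebra_simps)

lemma moment_dev_u: "has_bochner_integral law (dev_u k) 0"
proof -
  have "has_bochner_integral law (\<lambda>x. dev_u k x) (m $ tri_row k * 0 + m $ tri_col k * 0
   + (\<Sigma> $ tri_row k $ tri_col k - \<Sigma> $ tri_row k $ tri_col k * 1))"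
    unfolding dev_u_def by (intro has_bochner_integral_add has_bochner_integral_diff
      has_bochner_integral_mult_right moment0 moment1 moment2)
  then show ?thesis by simp
qed

lemma expect_c_stat: "expect \<theta> c_stat = mean_stat"
proof (rule expect_eq, rule has_bochner_integral_vec)
  fix s :: "'n + 'n tri"
  have "has_bochner_integral law (\<lambda>x. c_stat x $ s - mean_stat $ s) 0"
    using moment1 moment_dev_u by (cases s) (simp_all add: c_stat_centred)
  from has_bochner_integral_add[OF this has_bochner_integral_mult_right[OF moment0, of "mean_stat $ s"]]
  show "has_bochner_integral law (\<lambda>x. c_stat x $ s) (mean_stat $ s)" by simp
qed

lemma \<Sigma>_E_mu: "(\<Sigma> ** E_mu m) $ i $ k = \<Sigma> $ i $ tri_row k * m $ tri_col k + \<Sigma> $ i $ tri_col k * m $ tri_row k"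
  by (simp add: matrix_matrix_mult_def E_mu_nth distrib_left sum.distrib if_distrib[of "\<lambda>x. _ * x"] cong: if_cong)

lemma E_mu_\<Sigma>_E_mu: "(transpose (E_mu m) ** \<Sigma> ** E_mu m) $ k $ l
   = m $ tri_col k * (\<Sigma> ** E_mu m) $ tri_row k $ l + m $ tri_row k * (\<Sigma> ** E_mu m) $ tri_col k $ l"
  unfolding matrix_mul_assoc[symmetric]
  by (subst matrix_matrix_mult_def)
     (simp add: transpose_def E_mu_nth distrib_right sum.distrib if_distrib[of "\<lambda>x. x * _"] cong: if_cong)

text \<open>
  Only the linear part of \<^const>\<open>dev_u\<close> contributes, since third moments vanish.
\<close>

lemma moment_dev_dev_u: "has_bochner_integral law (\<lambda>x. dev i x * dev_u l x) ((\<Sigma> ** E_mu m) $ i $ l)"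
proof -
  let ?r = "tri_row l" and ?c = "tri_col l"
  have "has_bochner_integral law (\<lambda>x. m $ ?r * (dev i x * dev ?c x) + m $ ?c * (dev i x * dev ?r x)
     + (dev i x * dev ?r x * dev ?c x - \<Sigma> $ ?r $ ?c * dev i x))
     (m $ ?r * \<Sigma> $ i $ ?c + m $ ?c * \<Sigma> $ i $ ?r + (0 - \<Sigma> $ ?r $ ?c * 0))"
    by (intro has_bochner_integral_add has_bochner_integral_diff
      has_bochner_integral_mult_right moment1 moment2 moment3)
  moreover have "m $ ?r * (dev i x * dev ?c x) + m $ ?c * (dev i x * dev ?r x)
     + (dev i x * dev ?r x * dev ?c x - \<Sigma> $ ?r $ ?c * dev i x) = dev i x * dev_u l x" for x
    by (simp add: dev_u_def algebra_simps)
  ultimately show ?thesis by (simp add: \<Sigma>_E_mu mult.commute add.commute)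
qed

text \<open>
  The linear parts produce \<open>E\<^sup>T \<Sigma> E\<close>, the mixed terms vanish as odd moments, and in the fourth moment of
  the quadratic parts the pairing that does not mix the two positions cancels against the product
  of the means. The two pairings that remain are the entries of \<^const>\<open>guu0\<close>.
\<close>

lemma moment_dev_u_dev_u: "has_bochner_integral law (\<lambda>x. dev_u k x * dev_u l x)
  ((guu0 \<Sigma> + transpose (E_mu m) ** \<Sigma> ** E_mu m) $ k $ l)"
proof -
  let ?r = "tri_row k" and ?c = "tri_col k" and ?p = "tri_row l" and ?q = "tri_col l"
  have "has_bochner_integral law (\<lambda>x.
      m $ ?r * (dev ?c x * dev_u l x) + m $ ?c * (dev ?r x * dev_u l x) +
      (m $ ?p * (dev ?r x * dev ?c x * dev ?q x) + m $ ?q * (dev ?r x * dev ?c x * dev ?p x) +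
       (dev ?r x * dev ?c x * dev ?p x * dev ?q x - \<Sigma> $ ?p $ ?q * (dev ?r x * dev ?c x))
      - \<Sigma> $ ?r $ ?c * dev_u l x))
     (m $ ?r * (\<Sigma> ** E_mu m) $ ?c $ l + m $ ?c * (\<Sigma> ** E_mu m) $ ?r $ l +
      (m $ ?p * 0 + m $ ?q * 0 +
       ((\<Sigma> $ ?r $ ?c * \<Sigma> $ ?p $ ?q + \<Sigma> $ ?r $ ?p * \<Sigma> $ ?c $ ?q + \<Sigma> $ ?r $ ?q * \<Sigma> $ ?c $ ?p)
        - \<Sigma> $ ?p $ ?q * \<Sigma> $ ?r $ ?c)
      - \<Sigma> $ ?r $ ?c * 0))"
    by (intro has_bochner_integral_add has_bochner_integral_diff
      has_bochner_integral_mult_right moment_dev_u moment2 moment3 moment4 moment_dev_dev_u)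
  moreover have "m $ ?r * (dev ?c x * dev_u l x) + m $ ?c * (dev ?r x * dev_u l x) +
      (m $ ?p * (dev ?r x * dev ?c x * dev ?q x) + m $ ?q * (dev ?r x * dev ?c x * dev ?p x) +
       (dev ?r x * dev ?c x * dev ?p x * dev ?q x - \<Sigma> $ ?p $ ?q * (dev ?r x * dev ?c x))
      - \<Sigma> $ ?r $ ?c * dev_u l x) = dev_u k x * dev_u l x" for x
  proof -
    have "m $ ?p * (dev ?r x * dev ?c x * dev ?q x) + m $ ?q * (dev ?r x * dev ?c x * dev ?p x) +
       (dev ?r x * dev ?c x * dev ?p x * dev ?q x - \<Sigma> $ ?p $ ?q * (dev ?r x * dev ?c x))
      = dev ?r x * dev ?c x * dev_u l x"
      by (simp add: dev_u_def[of l] algebra_simps)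
    then show ?thesis by (simp add: dev_u_def[of k] algebra_simps)
  qed
  ultimately show ?thesis
    by (simp add: E_mu_\<Sigma>_E_mu guu0_nth algebra_simps)
qed

lemma fisher_nth:
  shows "fisher \<theta> $ Inl i $ Inl j = \<Sigma> $ i $ j"
    and "fisher \<theta> $ Inl i $ Inr l = (\<Sigma> ** E_mu m) $ i $ l"
    and "fisher \<theta> $ Inr k $ Inl j = (\<Sigma> ** E_mu m) $ j $ k"
    and "fisher \<theta> $ Inr k $ Inr l = (guu0 \<Sigma> + transpose (E_mu m) ** \<Sigma> ** E_mu m) $ k $ l"
  using expect_eq[OF moment2, of i j] expect_eq[OF moment_dev_dev_u, of i l] expect_eq[OF moment_dev_dev_u, of j k]
    expect_eq[OF moment_dev_u_dev_u, of k l]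
  by (simp_all add: fisher_def covar_def expect_c_stat c_stat_centred mult.commute)

text \<open>
  The natural gradient, for an arbitrary derivative \<open>(u, v)\<close> of the mean parameters.
\<close>

lemma matrix_inv_fisher_mult:
  "matrix_inv (fisher \<theta>) *v stack u v =
    stack (matrix_inv \<Sigma> *v u + E_mu m *v (matrix_inv (guu0 \<Sigma>) *v (transpose (E_mu m) *v u - v)))
          (matrix_inv (guu0 \<Sigma>) *v (v - transpose (E_mu m) *v u))"
  by (rule block_matrix_inv[OF fisher_nth \<Sigma>_sym invertible_\<Sigma> invertible_guu0])
     (use \<Sigma>_sym invertible_\<Sigma> in \<open>auto simp: sym_mats_def\<close>)

end

section \<open>The differential of the log-Cholesky coordinates\<close>

lemma lower_gram_nth:
  assumes "A \<in> lower_mats"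
  shows "(A ** transpose A) $ i $ j = (\<Sum>k | k < j. A $ i $ k * A $ j $ k) + A $ i $ j * A $ j $ j"
proof -
  have "(A ** transpose A) $ i $ j = (\<Sum>k\<in>UNIV. A $ i $ k * A $ j $ k)"
    by (simp add: matrix_matrix_mult_def transpose_def)
  also have "\<dots> = (\<Sum>k\<in>insert j {k. k < j}. A $ i $ k * A $ j $ k)"
    using assms by (intro sum.mono_neutral_right) (auto simp: lower_mats_def)
  finally show ?thesis by simp
qed

text \<open>
  The factor can be computed from the product one column after the other: once the columns before \<open>j\<close>
  are known, \<open>lower_gram_nth\<close> gives first the diagonal entry, as a positive square root, and then
  the rest of column \<open>j\<close>.
\<close>

lemma cholesky_unique:
  assumes L: "L \<in> lower_pos_mats" and M: "M \<in> lower_pos_mats"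
    and eq: "L ** transpose L = M ** transpose M"
  shows "L = M"
proof -
  have "\<forall>i. L $ i $ j = M $ i $ j" for j
  proof (induction j rule: less_induct)
    case (less j)
    have prod: "L $ i $ j * L $ j $ j = M $ i $ j * M $ j $ j" for i
      using lower_gram_nth[of L i j] lower_gram_nth[of M i j] L M less eq
      by (simp add: lower_pos_mats_def)
    have pos: "0 < L $ j $ j" "0 < M $ j $ j" using L M by (auto simp: lower_pos_mats_def)
    have "L $ j $ j = M $ j $ j"
      using prod[of j] pos by (metis less_eq_real_def power2_eq_iff_nonneg power2_eq_square)
    then show ?case using prod pos by simp
  qed
  then show ?thesis by (simp add: vec_eq_iff)
qed

lemma chol_gram: "L \<in> lower_pos_mats \<Longrightarrow> chol (L ** transpose L) = L"
  unfolding chol_def by (rule the_equality) (auto intro: cholesky_unique)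

lemma lower_pos_invertible: "L \<in> lower_pos_mats \<Longrightarrow> invertible L"
proof -
  assume L: "L \<in> lower_pos_mats"
  then have "det L = (\<Prod>i\<in>UNIV. L $ i $ i)"
    by (intro det_lowerdiagonal) (simp add: lower_pos_mats_def lower_mats_def)
  also have "\<dots> \<noteq> 0"
    using L by (simp add: lower_pos_mats_def less_imp_neq[symmetric])
  finally show ?thesis by (simp add: invertible_det_nz)
qed

lemma gram_in_sym_mats: "L ** transpose L \<in> sym_mats"
  by (simp add: sym_mats_def matrix_transpose_mul)

lemma gram_in_spd_mats:
  assumes "L \<in> lower_pos_mats"
  shows "L ** transpose L \<in> spd_mats"
proof -
  have "0 < x \<bullet> ((L ** transpose L) *v x)" if "x \<noteq> 0" for x
  proof -
    have "x \<bullet> ((L ** transpose L) *v x) = (x v* L) \<bullet> (x v* L)"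
      by (simp add: matrix_vector_mul_assoc[symmetric] dot_lmul_matrix)
    moreover have "inj ((*v) (transpose L))"
      by (rule inj_matrix_vector_mult) (use lower_pos_invertible[OF assms] transpose_invertible in auto)
    then have "x v* L \<noteq> 0"
      using that by (metis injD matrix_vector_mult_0_right transpose_matrix_vector)
    ultimately show ?thesis by simp
  qed
  then show ?thesis
    using gram_in_sym_mats[of L] by (simp add: spd_mats_def sym_mats_def)
qed

lemma lower_mats_mult:
  assumes "A \<in> lower_mats" "B \<in> lower_mats" shows "A ** B \<in> lower_mats"
proof -
  have "(A ** B) $ i $ j = 0" if "i < j" for i j
  proof -
    have zero: "A $ i $ k * B $ k $ j = 0" for k
      using assms that by (cases "i < k") (auto simp: lower_mats_def)
    show ?thesis
      unfolding matrix_matrix_mult_def vec_lambda_beta by (rule sum.neutral) (use zero in blast)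
  qed
  then show ?thesis by (simp add: lower_mats_def)
qed

lemma inj_on_vecl: "inj_on vecl lower_pos_mats"
proof (rule inj_onI)
  fix A B assume A: "A \<in> lower_pos_mats" and B: "B \<in> lower_pos_mats" and eq: "vecl A = vecl B"
  have "vecs A $ k = vecs B $ k" for k
  proof -
    have "vecl A $ k = vecl B $ k" using eq by simp
    then show ?thesis using A B by (auto simp: vecl_def vecs_def lower_pos_mats_def split: if_splits)
  qed
  then have "vecs A = vecs B" by (simp add: vec_eq_iff)
  then have "lower_of (vecs A) = lower_of (vecs B)" by simp
  then show "A = B" using A B by (simp add: lower_of_vecs lower_pos_mats_def)
qed

lemma vecl_inv_in: "vecl_inv \<nu> \<in> lower_pos_mats"
proof -
  let ?L = "lower_of (\<chi> k. if tri_row k = tri_col k then exp (\<nu> $ k) else \<nu> $ k)"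
  have "?L \<in> lower_pos_mats"
    using lower_of_in by (simp add: lower_pos_mats_def) (simp add: lower_of_def)
  moreover have "vecl ?L = \<nu>"
    by (simp add: vecl_def lower_of_def vec_eq_iff tri_le tri_of_diag)
  ultimately have "vecl_inv \<nu> = ?L"
    unfolding vecl_inv_def by (intro the_inv_into_f_eq inj_on_vecl)
  then show ?thesis
    using \<open>?L \<in> lower_pos_mats\<close> by simp
qed

text \<open>
  A derivative within a set that is not open need not be unique, but its value in the direction \<open>h\<close>
  is determined as soon as the set contains a segment through \<open>x\<close> in that direction, because it
  is then a derivative along the segment.
\<close>

lemma differential_eq:
  assumes F: "(F has_derivative F') (at x within S)"
    and e: "0 < e" "\<And>t. \<bar>t\<bar> < e \<Longrightarrow> x + t *\<^sub>R h \<in> S"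
  shows "differential S F x h = F' h"
proof -
  have line: "((\<lambda>t. F (x + t *\<^sub>R h)) has_derivative (\<lambda>t. G (t *\<^sub>R h))) (at 0)"
    if "(F has_derivative G) (at x within S)" for G
  proof -
    have "((\<lambda>t. x + t *\<^sub>R h) has_derivative (\<lambda>t. t *\<^sub>R h)) (at 0 within ball 0 e)"
      by (auto intro!: derivative_eq_intros)
    moreover have "(F has_derivative G) (at (x + 0 *\<^sub>R h) within (\<lambda>t. x + t *\<^sub>R h) ` ball 0 e)"
    proof -
      have "(\<lambda>t. x + t *\<^sub>R h) ` ball 0 e \<subseteq> S"
        by (auto intro!: e(2) simp: dist_real_def)
      then show ?thesis using has_derivative_subset[OF that] by simp
    qed
    ultimately have "((\<lambda>t. F (x + t *\<^sub>R h)) has_derivative (\<lambda>t. G (t *\<^sub>R h))) (at 0 within ball 0 e)"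
      by (rule has_derivative_in_compose)
    then show ?thesis using e(1) at_within_open[of "0::real" "ball 0 e"] by simp
  qed
  have "(F has_derivative differential S F x) (at x within S)"
    unfolding differential_def using F by (metis differentiableI frechet_derivative_works)
  from has_derivative_unique[OF line[OF this] line[OF F]]
  have "(\<lambda>t. differential S F x (t *\<^sub>R h)) 1 = (\<lambda>t. F' (t *\<^sub>R h)) 1" by metis
  then show ?thesis by simp
qed

lemma open_pos_diag: "open {v :: real^('n::{finite,wellorder} tri). \<forall>i. 0 < v $ tri_of i i}"
proof -
  have "{v :: real^('n tri). \<forall>i. 0 < v $ tri_of i i} = (\<Inter>i. {v. 0 < v $ tri_of i i})" by auto
  moreover have "open \<dots>"
    by (intro open_INT ballI open_Collect_less continuous_intros) auto
  ultimately show ?thesis by simp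
qed

lemma lower_of_pos: "lower_of v \<in> lower_pos_mats \<longleftrightarrow> (\<forall>i. 0 < v $ tri_of i i)"
  using lower_of_in[of v] by (simp add: lower_pos_mats_def) (simp add: lower_of_def)

lemma vecl_has_derivative:
  assumes "L \<in> lower_pos_mats"
  shows "(vecl has_derivative (\<lambda>H. vecl_jac L *v vecs H)) (at L within S)"
proof -
  have entry: "((\<lambda>A. A $ i $ j) has_derivative (\<lambda>H. H $ i $ j)) (at L within S)" for i j
    by (intro bounded_linear_imp_has_derivative
        bounded_linear_compose[OF bounded_linear_vec_nth bounded_linear_vec_nth])
  have "((\<lambda>A. vecl A $ k) has_derivative (\<lambda>H. (vecl_jac L *v vecs H) $ k)) (at L within S)" for k
  proof -
    have jac: "(vecl_jac L *v vecs H) $ k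
      = (if tri_row k = tri_col k then 1 / L $ tri_row k $ tri_col k else 1) * H $ tri_row k $ tri_col k" for H
      by (simp add: vecl_jac_def matrix_vector_mult_def vecs_def if_distrib[of "\<lambda>x. x * _"] cong: if_cong)
    show ?thesis
    proof (cases "tri_row k = tri_col k")
      case True
      have "((\<lambda>A. ln (A $ tri_row k $ tri_col k)) has_derivative
          (\<lambda>H. H $ tri_row k $ tri_col k * (1 / L $ tri_row k $ tri_col k))) (at L within S)"
        using assms True
        by (auto intro!: derivative_eq_intros entry simp: lower_pos_mats_def field_simps)
      then show ?thesis using True by (simp add: vecl_def jac mult.commute)
    next
      case False
      then show ?thesis using entry by (simp add: vecl_def jac)
    qed
  qed
  then show ?thesis
    by (subst has_derivative_componentwise_within) (auto simp: Basis_vec_def inner_axis)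
qed

lemma differential_vecl:
  assumes L: "L \<in> lower_pos_mats" and H: "H \<in> lower_mats"
  shows "differential lower_pos_mats vecl L H = vecl_jac L *v vecs H"
proof -
  let ?T = "{t. \<forall>i. 0 < vecs (L + t *\<^sub>R H) $ tri_of i i}"
  have "open ((\<lambda>t. vecs L + t *\<^sub>R vecs H) -` {v. \<forall>i. 0 < v $ tri_of i i})"
    by (intro open_vimage open_pos_diag continuous_intros)
  moreover have "0 \<in> (\<lambda>t. vecs L + t *\<^sub>R vecs H) -` {v. \<forall>i. 0 < v $ tri_of i i}"
    using L by (simp add: lower_pos_mats_def vecs_def)
  ultimately obtain e where e: "e > 0"
    "ball 0 e \<subseteq> (\<lambda>t. vecs L + t *\<^sub>R vecs H) -` {v. \<forall>i. 0 < v $ tri_of i i}"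
    by (meson openE)
  show ?thesis
  proof (rule differential_eq[OF vecl_has_derivative[OF L] e(1)])
    fix t :: real assume "\<bar>t\<bar> < e"
    then have "t \<in> ball 0 e" by simp
    with e(2) have pos: "\<forall>i. 0 < (vecs L + t *\<^sub>R vecs H) $ tri_of i i" by blast
    have "lower_of (vecs L + t *\<^sub>R vecs H) = L + t *\<^sub>R H"
      using L H lower_of_vecs[of L] lower_of_vecs[of H]
      by (simp add: linear_add[OF linear_lower_of] linear_scale[OF linear_lower_of] lower_pos_mats_def)
    then show "L + t *\<^sub>R H \<in> lower_pos_mats"
      using pos lower_of_pos by metis
  qed
qed

text \<open>
  The map \<open>L \<mapsto> L L\<^sup>T\<close> in coordinates. Working in \<open>vecs\<close> coordinates on both sides makes domain and
  codomain the same Euclidean space, as the inverse function theorem and invariance of domain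
  require.
\<close>

definition gram_vecs :: "real^('n::{finite,wellorder} tri) \<Rightarrow> real^('n tri)" where
  "gram_vecs v = vecs (lower_of v ** transpose (lower_of v))"

text \<open>
  The lower triangular solution \<open>X\<close> of \<open>X L\<^sup>T + L X\<^sup>T = H\<close>: \<open>L\<close> times the lower triangle of
  \<open>L\<^sup>-\<^sup>1 H L\<^sup>-\<^sup>T\<close> with halved diagonal.
\<close>

definition chol_deriv :: "real^'n::{finite,wellorder}^'n::_ \<Rightarrow> real^'n::_^'n::_ \<Rightarrow> real^'n::_^'n::_" where
  "chol_deriv L H = L ** lower_of (Kt_mat *v vecs (matrix_inv L ** H ** transpose (matrix_inv L)))"

lemma matrix_mult_add_left: "(A + B) ** C = A ** C + B ** C"
  for A B :: "real^'n^'m"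
  by (simp add: matrix_matrix_mult_def vec_eq_iff distrib_right sum.distrib)

lemma linear_matrix_mult: "linear (\<lambda>A :: real^'n^'m. B ** A)" "linear (\<lambda>A :: real^'n^'m. A ** C)"
  for B :: "real^'m^'k" and C :: "real^'k^'n"
  by (auto intro!: linearI simp: matrix_add_ldistrib matrix_mult_add_left matrix_scalar_ac scalar_matrix_assoc)

lemma linear_transpose: "linear (transpose :: real^'n^'m \<Rightarrow> real^'m^'n)"
  by (auto intro!: linearI simp: transpose_def vec_eq_iff)

text \<open>
  Halving the diagonal compensates for its being counted twice in the sum with the transpose.
\<close>

lemma half_lower_add_transpose:
  assumes "A \<in> sym_mats"
  shows "lower_of (Kt_mat *v vecs A) + transpose (lower_of (Kt_mat *v vecs A)) = A"
  using assms
  by (auto simp: lower_of_def transpose_def vec_eq_iff Kt_mat_mult vecs_def sym_mats_def max_def min_def)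

lemma chol_deriv_solves:
  assumes L: "L \<in> lower_pos_mats" and H: "H \<in> sym_mats"
  shows "chol_deriv L H ** transpose L + L ** transpose (chol_deriv L H) = H"
proof -
  define A where "A = matrix_inv L ** H ** transpose (matrix_inv L)"
  define Y where "Y = lower_of (Kt_mat *v vecs A)"
  have LL: "L ** matrix_inv L = mat 1"
    by (rule invertible_mult_matrix_inv[OF lower_pos_invertible[OF L]])
  then have LLt: "transpose (matrix_inv L) ** transpose L = mat 1"
    by (metis matrix_transpose_mul transpose_mat)
  have "chol_deriv L H ** transpose L + L ** transpose (chol_deriv L H) = L ** (Y + transpose Y) ** transpose L"
    by (simp add: chol_deriv_def Y_def A_def matrix_transpose_mul matrix_mul_assoc matrix_add_ldistrib matrix_mult_add_left)
  also have "Y + transpose Y = A"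
    unfolding Y_def by (rule half_lower_add_transpose) (simp add: A_def sym_mats_sandwich H)
  also have "L ** A ** transpose L = (L ** matrix_inv L) ** H ** (transpose (matrix_inv L) ** transpose L)"
    by (simp add: A_def matrix_mul_assoc)
  finally show ?thesis by (simp add: LL LLt)
qed

lemma chol_deriv_lower: "L \<in> lower_pos_mats \<Longrightarrow> chol_deriv L H \<in> lower_mats"
  unfolding chol_deriv_def by (rule lower_mats_mult) (simp_all add: lower_of_in lower_pos_mats_def)

lemma gram_vecs_has_derivative:
  "(gram_vecs has_derivative (\<lambda>h. vecs (lower_of h ** transpose (lower_of v) + lower_of v ** transpose (lower_of h)))) (at v)"
proof -
  define B where "B = (\<lambda>(v::real^('a tri)) w. vecs (lower_of v ** transpose (lower_of w)))"
  have "bilinear B"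
    unfolding bilinear_def B_def
  proof (intro conjI allI)
    show "linear (\<lambda>w. vecs (lower_of v ** transpose (lower_of w)))" for v :: "real^('a tri)"
      using linear_compose[OF linear_compose[OF linear_compose[OF linear_lower_of linear_transpose]
        linear_matrix_mult(1)] linear_vecs] by (simp add: o_def)
    show "linear (\<lambda>v. vecs (lower_of v ** transpose (lower_of w)))" for w :: "real^('a tri)"
      using linear_compose[OF linear_compose[OF linear_lower_of linear_matrix_mult(2)] linear_vecs]
      by (simp add: o_def)
  qed
  then have "bounded_bilinear B" by (simp add: bilinear_conv_bounded_bilinear)
  from bounded_bilinear.FDERIV[OF this has_derivative_ident has_derivative_ident, of v UNIV]
  show ?thesis
    by (simp add: B_def gram_vecs_def[abs_def] linear_add[OF linear_vecs] add.commute)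
qed

lemma symm_of_gram_vecs: "symm_of (gram_vecs v) = lower_of v ** transpose (lower_of v)"
  unfolding gram_vecs_def by (rule symm_of_vecs[OF gram_in_sym_mats])

lemma chol_symm_of_gram_vecs: "lower_of v \<in> lower_pos_mats \<Longrightarrow> chol (symm_of (gram_vecs v)) = lower_of v"
  by (simp add: symm_of_gram_vecs chol_gram)

lemma continuous_on_gram_vecs: "continuous_on S gram_vecs"
  by (intro continuous_at_imp_continuous_on ballI has_derivative_continuous[OF gram_vecs_has_derivative])

text \<open>
  Invariance of domain. It guarantees that every symmetric matrix close to \<open>L L\<^sup>T\<close> has a Cholesky factor.
\<close>

lemma open_gram_vecs: "open (gram_vecs ` {v. \<forall>i. 0 < v $ tri_of i i})"
proof (rule invariance_of_domain[OF continuous_on_gram_vecs open_pos_diag])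
  show "inj_on gram_vecs {v. \<forall>i. 0 < v $ tri_of i i}"
  proof (rule inj_onI)
    fix v w
    assume "v \<in> {v. \<forall>i. 0 < v $ tri_of i i}" "w \<in> {v. \<forall>i. 0 < v $ tri_of i i}" "gram_vecs v = gram_vecs w"
    then have "lower_of v = lower_of w"
      using chol_symm_of_gram_vecs[of v] chol_symm_of_gram_vecs[of w] by (simp add: lower_of_pos)
    then have "vecs (lower_of v) = vecs (lower_of w)" by (rule arg_cong)
    then show "v = w" by simp
  qed
qed

text \<open>
  The Cholesky map is the inverse of \<^const>\<open>gram_vecs\<close>, whose derivative has the right inverse given by
  \<^const>\<open>chol_deriv\<close>. The map \<open>symm_of \<circ> vecs\<close> is the identity on symmetric directions and makes the
  derivative depend on the coordinates only.
\<close>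

lemma chol_has_derivative:
  fixes L :: "real^'n::{finite,wellorder}^'n::_"
  assumes L: "L \<in> lower_pos_mats"
  shows "(chol has_derivative (\<lambda>H. chol_deriv L (symm_of (vecs H)))) (at (L ** transpose L) within spd_mats)"
proof -
  define V where "V = {v :: real^('n tri). \<forall>i. 0 < v $ tri_of i i}"
  define g :: "real^('n tri) \<Rightarrow> real^('n tri)" where "g = (\<lambda>w. vecs (chol (symm_of w)))"
  define v where "v = vecs L"
  have Lv: "lower_of v = L" using L by (simp add: v_def lower_of_vecs lower_pos_mats_def)
  have v: "v \<in> V" using L by (simp add: V_def Lv flip: lower_of_pos)
  have gF: "g (gram_vecs w) = w" if "w \<in> V" for w
    using that by (simp add: g_def V_def chol_symm_of_gram_vecs lower_of_pos)
  have "(g has_derivative (\<lambda>h. vecs (chol_deriv L (symm_of h)))) (at (gram_vecs v))"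
  proof (rule has_derivative_inverse_strong[OF _ v])
    show "open V" unfolding V_def by (rule open_pos_diag)
    show "continuous_on V gram_vecs" by (rule continuous_on_gram_vecs)
    show "(\<lambda>h. vecs (lower_of h ** transpose L + L ** transpose (lower_of h))) \<circ> (\<lambda>h. vecs (chol_deriv L (symm_of h))) = id"
      by (simp add: fun_eq_iff lower_of_vecs chol_deriv_lower[OF L] chol_deriv_solves[OF L] symm_of_in)
    show "(gram_vecs has_derivative (\<lambda>h. vecs (lower_of h ** transpose L + L ** transpose (lower_of h)))) (at v)"
      using gram_vecs_has_derivative[of v] by (simp add: Lv)
  qed (rule gF)
  moreover have "gram_vecs v = vecs (L ** transpose L)" by (simp add: gram_vecs_def Lv)
  ultimately have g: "(g has_derivative (\<lambda>h. vecs (chol_deriv L (symm_of h)))) (at (vecs (L ** transpose L)))" by simp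
  have lin: "bounded_linear vecs" "bounded_linear lower_of"
    using linear_vecs linear_lower_of linear_conv_bounded_linear by blast+
  have "((\<lambda>A. g (vecs A)) has_derivative (\<lambda>H. vecs (chol_deriv L (symm_of (vecs H))))) (at (L ** transpose L) within spd_mats)"
    by (rule has_derivative_compose[OF bounded_linear_imp_has_derivative[OF lin(1)] g])
  from bounded_linear.has_derivative[OF lin(2) this]
  have d: "((\<lambda>A. lower_of (g (vecs A))) has_derivative (\<lambda>H. lower_of (vecs (chol_deriv L (symm_of (vecs H)))))) (at (L ** transpose L) within spd_mats)" .
  have low: "lower_of (vecs (chol_deriv L H)) = chol_deriv L H" for H
    by (rule lower_of_vecs[OF chol_deriv_lower[OF L]])
  have "open (vecs -` (gram_vecs ` V))"
    unfolding V_def by (intro open_vimage open_gram_vecs linear_continuous_on lin)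
  moreover have "L ** transpose L \<in> vecs -` (gram_vecs ` V)"
    using v \<open>gram_vecs v = _\<close> by (metis imageI vimageI)
  ultimately obtain e where e: "e > 0" "ball (L ** transpose L) e \<subseteq> vecs -` (gram_vecs ` V)"
    by (meson openE)
  show ?thesis
  proof (rule has_derivative_transform_within[OF d[unfolded low] e(1)])
    show "L ** transpose L \<in> spd_mats" by (rule gram_in_spd_mats[OF L])
    fix A assume A: "A \<in> spd_mats" "dist A (L ** transpose L) < e"
    then have "A \<in> ball (L ** transpose L) e" by (simp add: dist_commute)
    with e(2) obtain w where w: "w \<in> V" "vecs A = gram_vecs w" by blast
    have "A = symm_of (gram_vecs w)"
      using A w symm_of_vecs[of A] by (simp add: spd_mats_def sym_mats_def)
    then have "chol A = lower_of w"
      using w by (simp add: chol_symm_of_gram_vecs V_def lower_of_pos)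
    then show "lower_of (g (vecs A)) = chol A"
      using w gF by simp
  qed
qed

lemma differential_chol:
  assumes L: "L \<in> lower_pos_mats" and H: "H \<in> sym_mats"
  shows "differential spd_mats chol (L ** transpose L) H = chol_deriv L H"
proof -
  let ?P = "L ** transpose L" and ?V = "{v. \<forall>i. 0 < v $ tri_of i i}"
  let ?path = "\<lambda>t. vecs ?P + t *\<^sub>R vecs H"
  have "gram_vecs (vecs L) = vecs ?P" "vecs L \<in> ?V"
    using L lower_of_vecs[of L] lower_of_pos[of "vecs L"] by (simp_all add: gram_vecs_def lower_pos_mats_def)
  then have "0 \<in> ?path -` (gram_vecs ` ?V)" by (simp add: image_iff) metis
  moreover have "open (?path -` (gram_vecs ` ?V))"
    by (intro open_vimage open_gram_vecs continuous_intros)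
  ultimately obtain e where e: "e > 0" "ball 0 e \<subseteq> ?path -` (gram_vecs ` ?V)"
    by (meson openE)
  have "differential spd_mats chol ?P H = chol_deriv L (symm_of (vecs H))"
  proof (rule differential_eq[OF chol_has_derivative[OF L] e(1)])
    fix t :: real assume "\<bar>t\<bar> < e"
    then have "t \<in> ball 0 e" by simp
    with e(2) obtain w where w: "w \<in> ?V" "?path t = gram_vecs w" by blast
    have "?P + t *\<^sub>R H = symm_of (?path t)"
      using symm_of_vecs[OF gram_in_sym_mats[of L]] symm_of_vecs[OF H]
      by (simp add: linear_add[OF linear_symm_of] linear_scale[OF linear_symm_of])
    then show "?P + t *\<^sub>R H \<in> spd_mats"
      using w by (simp add: symm_of_gram_vecs gram_in_spd_mats lower_of_pos)
  qed
  then show ?thesis by (simp add: symm_of_vecs H)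
qed

lemma log_cholesky_differential:
  assumes L: "L \<in> lower_pos_mats" and H: "H \<in> sym_mats"
  shows "differential lower_pos_mats vecl L (differential spd_mats chol (L ** transpose L) H)
    = (Delta_mat L ** Kt_mat ** C_mat L) *v vecs H"
proof -
  let ?A = "matrix_inv L ** H ** transpose (matrix_inv L)"
  have "?A \<in> sym_mats" using H by (rule sym_mats_sandwich)
  then have "(Delta_mat L ** Kt_mat ** C_mat L) *v vecs H = vecl_jac L *v vecs (chol_deriv L H)"
    unfolding Delta_mat_def C_mat_def
    by (simp add: matrix_vector_mul_assoc[symmetric] D_mat_mult symm_of_vecs[OF H] kron_mvec
        pinv_D_mat_mvec E_mat_mult pinv_E_mat_mult chol_deriv_def)
  then show ?thesis
    by (simp add: differential_chol[OF L H] differential_vecl[OF L] chol_deriv_lower[OF L])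
qed

section \<open>The relaxed prediction equation\<close>

lemma has_vector_derivative_stack_iff:
  fixes f :: "real \<Rightarrow> real^'m::finite" and g :: "real \<Rightarrow> real^'k::finite"
  shows "((\<lambda>s. stack (f s) (g s)) has_vector_derivative stack f' g') F \<longleftrightarrow>
    (f has_vector_derivative f') F \<and> (g has_vector_derivative g') F"
proof
  have ub: "bounded_linear (upper_block :: real^('m + 'k) \<Rightarrow> real^'m)"
    and lb: "bounded_linear (lower_block :: real^('m + 'k) \<Rightarrow> real^'k)"
    unfolding linear_conv_bounded_linear[symmetric]
    by (auto intro!: linearI simp: upper_block_def lower_block_def vec_eq_iff)
  assume *: "((\<lambda>s. stack (f s) (g s)) has_vector_derivative stack f' g') F"
  show "(f has_vector_derivative f') F \<and> (g has_vector_derivative g') F"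
    using bounded_linear.has_vector_derivative[OF ub *] bounded_linear.has_vector_derivative[OF lb *] by simp
next
  have s: "bounded_linear (\<lambda>u. stack u 0 :: real^('m + 'k))" "bounded_linear (\<lambda>v. stack 0 v :: real^('m + 'k))"
    unfolding linear_conv_bounded_linear[symmetric]
    by (auto intro!: linearI simp: stack_def vec_eq_iff split: sum.split)
  have add: "stack u 0 + stack 0 v = stack u v" for u :: "real^'m" and v :: "real^'k"
    unfolding stack_eq_iff by simp
  assume "(f has_vector_derivative f') F \<and> (g has_vector_derivative g') F"
  then show "((\<lambda>s. stack (f s) (g s)) has_vector_derivative stack f' g') F"
    using has_vector_derivative_add[OF bounded_linear.has_vector_derivative[OF s(1), of f f' F]
        bounded_linear.has_vector_derivative[OF s(2), of g g' F]]
    by (simp add: add)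
qed

text \<open>
  The velocity of \<open>\<nu>\<close> that belongs to the velocity \<open>- vecs\<^sup>-\<^sup>1 (K\<^sup>-\<^sup>1 w)\<close> of the sum-of-squares matrix.
\<close>

lemma log_cholesky_velocity:
  assumes "L \<in> lower_pos_mats"
  shows "(differential lower_pos_mats vecl L \<circ> differential spd_mats chol (L ** transpose L))
      (- vecs_inv (matrix_inv K_mat *v w))
    = - ((Delta_mat L ** Kt_mat ** C_mat L ** matrix_inv K_mat) *v w)"
proof -
  let ?H = "symm_of (- (matrix_inv K_mat *v w))"
  have "- vecs_inv (matrix_inv K_mat *v w) = ?H"
    by (simp add: vecs_inv_eq linear_neg[OF linear_symm_of])
  then have "(differential lower_pos_mats vecl L \<circ> differential spd_mats chol (L ** transpose L))
      (- vecs_inv (matrix_inv K_mat *v w)) = (Delta_mat L ** Kt_mat ** C_mat L) *v vecs ?H"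
    by (simp add: log_cholesky_differential[OF assms symm_of_in])
  also have "\<dots> = - ((Delta_mat L ** Kt_mat ** C_mat L) *v (matrix_inv K_mat *v w))"
    using matrix_vector_mult_diff_distrib[of "Delta_mat L ** Kt_mat ** C_mat L" 0 "matrix_inv K_mat *v w"]
    by simp
  finally show ?thesis by (simp add: matrix_vector_mul_assoc)
qed

theorem proposition3:
  fixes f :: "real^'n::{finite,wellorder} \<Rightarrow> real^'n::_"
    and \<rho> :: "real^'n::_ \<Rightarrow> real^'w^'n::_"
    and \<Delta>t :: real and k :: nat
    and \<mu>k :: "real^'n::_" and \<Sigma>k :: "real^'n::_^'n::_" and \<theta>k :: "real^('n + 'n tri)"
    and \<theta>l :: "real \<Rightarrow> real^'n::_" and \<nu> :: "real \<Rightarrow> real^('n tri)"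
  assumes coeffs: "sde_coeffs f \<rho>"
    and dt: "0 < \<Delta>t"
    and spd: "\<Sigma>k \<in> spd_mats"
    and nat_k: "\<theta>k = natural_param \<mu>k \<Sigma>k"
    and init_l: "\<theta>l (real k * \<Delta>t) = upper_block \<theta>k"
    and init_nu: "\<nu> (real k * \<Delta>t) = vecl (chol ((1/2) *\<^sub>R matrix_inv \<Sigma>k))"
    and cont_l: "continuous_on {real k * \<Delta>t..<(real k + 1) * \<Delta>t} \<theta>l"
    and cont_nu: "continuous_on {real k * \<Delta>t..<(real k + 1) * \<Delta>t} \<nu>"
  shows "\<forall>t\<in>{real k * \<Delta>t<..<(real k + 1) * \<Delta>t}.
    sos_relaxation_at f \<rho> \<theta>l \<nu> t \<longleftrightarrow>
    (let \<theta> = sos_theta (\<theta>l t) (\<nu> t);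
         \<mu> = mean_of \<theta>;
         \<Sigma> = cov_of \<theta>;
         L = chol ((1/2) *\<^sub>R matrix_inv \<Sigma>)
     in ((\<lambda>s. stack (\<theta>l s) (\<nu> s)) has_vector_derivative
          stack
            (matrix_inv \<Sigma> *v deta_l f \<rho> \<theta> +
             E_mu \<mu> *v (matrix_inv (guu0 \<Sigma>) *v
               (transpose (E_mu \<mu>) *v deta_l f \<rho> \<theta> - deta_u f \<rho> \<theta>)))
            (- ((Delta_mat L ** Kt_mat ** C_mat L ** matrix_inv K_mat ** matrix_inv (guu0 \<Sigma>)) *v
               (deta_u f \<rho> \<theta> - transpose (E_mu \<mu>) *v deta_l f \<rho> \<theta>)))) (at t))"
proof
  fix t assume "t \<in> {real k * \<Delta>t<..<(real k + 1) * \<Delta>t}"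
  define L where "L = vecl_inv (\<nu> t)"
  have L: "L \<in> lower_pos_mats"
    unfolding L_def by (rule vecl_inv_in)
  have P: "sos_P (\<nu> t) = L ** transpose L"
    by (simp add: sos_P_def L_def)
  have "sos_P (\<nu> t) \<in> spd_mats"
    unfolding P by (rule gram_in_spd_mats[OF L])
  then interpret N: gaussian "sos_P (\<nu> t)" "\<theta>l t"
    by unfold_locales
  have \<theta>: "sos_theta (\<theta>l t) (\<nu> t) = N.\<theta>"
    by (simp add: sos_theta_def N.\<theta>_def)
  \<comment> \<open>The factor in the claim is the one encoded by \<open>\<nu> t\<close>, since \<open>\<Sigma>\<^sup>-\<^sup>1 / 2\<close> is the matrix \<open>P\<close>.\<close>
  have "(1/2) *\<^sub>R matrix_inv N.\<Sigma> = L ** transpose L"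
    unfolding N.matrix_inv_\<Sigma> by (simp add: P)
  then have chol_L: "chol ((1/2) *\<^sub>R matrix_inv N.\<Sigma>) = L" "chol (sos_P (\<nu> t)) = L"
    by (simp_all add: chol_gram L P)
  let ?u = "deta_l f \<rho> N.\<theta>" and ?v = "deta_u f \<rho> N.\<theta>"
  let ?w = "matrix_inv (guu0 N.\<Sigma>) *v (?v - transpose (E_mu N.m) *v ?u)"
  have inv: "matrix_inv (fisher N.\<theta>) *v deta f \<rho> N.\<theta> =
      stack (matrix_inv N.\<Sigma> *v ?u + E_mu N.m *v (matrix_inv (guu0 N.\<Sigma>) *v
               (transpose (E_mu N.m) *v ?u - ?v))) ?w"
    unfolding deta_def by (rule N.matrix_inv_fisher_mult)
  have vel: "(differential lower_pos_mats vecl L \<circ> differential spd_mats chol (sos_P (\<nu> t))) (sos_dP f \<rho> N.\<theta>)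
      = - ((Delta_mat L ** Kt_mat ** C_mat L ** matrix_inv K_mat ** matrix_inv (guu0 N.\<Sigma>)) *v
               (?v - transpose (E_mu N.m) *v ?u))"
    unfolding sos_dP_def inv lower_block_stack
    unfolding P log_cholesky_velocity[OF L]
    by (simp only: matrix_vector_mul_assoc)
  show "sos_relaxation_at f \<rho> \<theta>l \<nu> t \<longleftrightarrow>
    (let \<theta> = sos_theta (\<theta>l t) (\<nu> t);
         \<mu> = mean_of \<theta>;
         \<Sigma> = cov_of \<theta>;
         L = chol ((1/2) *\<^sub>R matrix_inv \<Sigma>)
     in ((\<lambda>s. stack (\<theta>l s) (\<nu> s)) has_vector_derivative
          stack
            (matrix_inv \<Sigma> *v deta_l f \<rho> \<theta> +
             E_mu \<mu> *v (matrix_inv (guu0 \<Sigma>) *v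
               (transpose (E_mu \<mu>) *v deta_l f \<rho> \<theta> - deta_u f \<rho> \<theta>)))
            (- ((Delta_mat L ** Kt_mat ** C_mat L ** matrix_inv K_mat ** matrix_inv (guu0 \<Sigma>)) *v
               (deta_u f \<rho> \<theta> - transpose (E_mu \<mu>) *v deta_l f \<rho> \<theta>)))) (at t))"
    unfolding sos_relaxation_at_def Let_def \<theta> N.mean_of_eq N.cov_of_eq chol_L has_vector_derivative_stack_iff
      vel inv upper_block_stack ..
qed

end
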